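(* Let $C_n$ be the cycle with vertices $v_0,v_1,\dots,v_{n-1}$ (in cyclic order), and let $C_n^+$ be a graph obtained from $C_n$ by adding some edges from the set $E_0=\{v_iv_j: i+j=\nu\}$, where $\nu=n$ if $n$ is odd and $\nu\in\{n,n-1\}$ if $n$ is even. Then $\alpha(F_k(C_n^+))=\alpha(C_n^+)$ for $k=1,2$.
   Context: $\alpha(G)$ denotes the algebraic connectivity of $G$, i.e. the second smallest eigenvalue of its Laplacian matrix. For a graph $G=(V,E)$ on $n$ vertices and $1\le k\le n-1$, the $k$-token graph $F_k(G)$ has as vertices the $k$-subsets of $V$, two $k$-subsets being adjacent iff their symmetric difference is $\{a,b\}$ with $ab\in E$. *)

theory Defs
  imports "Jordan_Normal_Form.Char_Poly"
begin

type_synonym 'a graph = "'a set \<times> 'a set set"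

abbreviation verts :: "'a graph \<Rightarrow> 'a set" where "verts \<equiv> fst"

abbreviation edges :: "'a graph \<Rightarrow> 'a set set" where "edges \<equiv> snd"

definition vertex_degree :: "'a graph \<Rightarrow> 'a \<Rightarrow> nat" where
  "vertex_degree G u = card {v \<in> verts G. {u, v} \<in> edges G}"

text \<open>A matrix needs an ordering of the vertices; a different ordering gives a
  permutation-similar matrix, so the spectrum does not depend on the choice.\<close>

definition vertex_list :: "'a graph \<Rightarrow> 'a list" where
  "vertex_list G = (SOME vs. distinct vs \<and> set vs = verts G)"

definition laplacian_matrix :: "'a graph \<Rightarrow> real mat" where
  "laplacian_matrix G =
    (let vs = vertex_list G; n = length vs in
     mat n n (\<lambda>(i, j).
       if i = j then real (vertex_degree G (vs ! i))
       else if {vs ! i, vs ! j} \<in> edges G then -1 else 0))"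

text \<open>The eigenvalues are listed in increasing order and repeated according to multiplicity;
  list indices start at 0, so the second smallest one has index 1.\<close>

definition algebraic_connectivity :: "'a graph \<Rightarrow> real" where
  "algebraic_connectivity G =
    sorted_list_of_multiset (proots (char_poly (laplacian_matrix G))) ! 1"

definition token_graph :: "nat \<Rightarrow> 'a graph \<Rightarrow> 'a set graph" where
  "token_graph k G =
    (let W = {A. A \<subseteq> verts G \<and> finite A \<and> card A = k} in
     (W, {{A, B} | A B. A \<in> W \<and> B \<in> W \<and>
           (\<exists>a b. {a, b} \<in> edges G \<and> sym_diff A B = {a, b})}))"

definition cycle_graph :: "nat \<Rightarrow> nat graph" where
  "cycle_graph n = ({..<n}, {{i, (i + 1) mod n} | i. i < n})"

definition add_edges :: "'a graph \<Rightarrow> 'a set set \<Rightarrow> 'a graph" where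
  "add_edges G S = (verts G, edges G \<union> S)"

text \<open>The condition \<open>i \<noteq> j\<close> excludes the loop at \<open>\<nu> / 2\<close> for even \<open>\<nu>\<close>.\<close>

definition sum_edges :: "nat \<Rightarrow> nat \<Rightarrow> nat set set" where
  "sum_edges n \<nu> = {{i, j} | i j. i < n \<and> j < n \<and> i \<noteq> j \<and> i + j = \<nu>}"

end

theory Submission
  imports Defs
begin

text \<open>
  Both algebraic connectivities equal \<open>l = 2 - 2 * cos (2 * pi / n)\<close>. The eigenvalue \<open>l\<close> of
  the cycle has an eigenfunction that is symmetric under \<open>i \<mapsto> \<nu> - i\<close>; the added edges do not see
  it, so it survives in \<open>C\<^sub>n\<^sup>+\<close>, and summing it over the tokens gives an eigenfunction of the
  token graph. Since adding edges only increases the Dirichlet form, it remains to prove the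
  Poincare inequality with constant \<open>l\<close> on \<open>C\<^sub>n\<close> and on \<open>F\<^sub>2(C\<^sub>n)\<close>. On \<open>C\<^sub>n\<close> this is
  Parseval's identity. On \<open>F\<^sub>2(C\<^sub>n)\<close> a Fourier transform in the centre of mass of the two tokens
  leaves, for each mode \<open>r\<close>, a quadratic form on a path in the distance \<open>d\<close> of the tokens: mode \<open>0\<close>
  reduces to a cycle of length \<open>n - 1\<close>, modes \<open>1\<close> and \<open>n - 1\<close> have, up to signs, the ground state
  \<open>cos (pi * d / n)\<close> with eigenvalue exactly \<open>l\<close>, and all others are bounded below by
  \<open>2 - 2 * \<bar>cos (pi * r / n)\<bar> \<ge> l\<close>.
\<close>

section \<open>Algebraic connectivity and the Dirichlet form\<close>

text \<open>The Laplacian as an operator on functions, free of the vertex ordering behind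
  \<open>laplacian_matrix\<close>.\<close>

definition graph_laplacian :: "'a graph \<Rightarrow> ('a \<Rightarrow> real) \<Rightarrow> 'a \<Rightarrow> real" where
  "graph_laplacian G f u = (\<Sum>v | v \<in> verts G \<and> {u, v} \<in> edges G. f u - f v)"

text \<open>The double sum meets every edge in both orientations, hence the division by 2.\<close>

definition dirichlet_form :: "'a graph \<Rightarrow> ('a \<Rightarrow> real) \<Rightarrow> real" where
  "dirichlet_form G f =
    (\<Sum>u\<in>verts G. \<Sum>v | v \<in> verts G \<and> {u, v} \<in> edges G. (f u - f v)\<^sup>2) / 2"

lemma sum_adjacent_swap:
  fixes \<phi> :: "'a \<Rightarrow> 'a \<Rightarrow> real"
  assumes "finite V"
  shows "(\<Sum>u\<in>V. \<Sum>v | v \<in> V \<and> {u, v} \<in> E. \<phi> u v) = (\<Sum>u\<in>V. \<Sum>v | v \<in> V \<and> {u, v} \<in> E. \<phi> v u)"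
proof -
  have "(\<Sum>u\<in>V. \<Sum>v | v \<in> V \<and> {u, v} \<in> E. \<phi> u v) = (\<Sum>v\<in>V. \<Sum>u | u \<in> V \<and> {u, v} \<in> E. \<phi> u v)"
    using assms by (rule sum.swap_restrict) (rule assms)
  then show ?thesis by (simp add: insert_commute)
qed

text \<open>The summand \<open>f u - f v\<close> changes sign when the ends of an edge are
  exchanged, so the total equals its own negative.\<close>

lemma sum_graph_laplacian:
  assumes "finite (verts G)"
  shows "(\<Sum>u\<in>verts G. graph_laplacian G f u) = 0"
proof -
  have "(\<Sum>u\<in>verts G. graph_laplacian G f u) = - (\<Sum>u\<in>verts G. graph_laplacian G f u)"
    unfolding graph_laplacian_def
    by (subst sum_adjacent_swap[OF assms]) (simp flip: sum_negf)
  then show ?thesis by simp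
qed

text \<open>Discrete Green formula: averaging the sum with its copy under exchange of the ends of
  each edge turns \<open>f u * (f u - f v)\<close> into half a square.\<close>

lemma sum_mult_graph_laplacian:
  assumes "finite (verts G)"
  shows "(\<Sum>u\<in>verts G. f u * graph_laplacian G f u) = dirichlet_form G f"
proof -
  let ?S = "\<Sum>u\<in>verts G. f u * graph_laplacian G f u"
  have "?S = (\<Sum>u\<in>verts G. \<Sum>v | v \<in> verts G \<and> {u, v} \<in> edges G. f u * (f u - f v))"
    by (simp add: graph_laplacian_def sum_distrib_left)
  moreover from this have "?S = (\<Sum>u\<in>verts G. \<Sum>v | v \<in> verts G \<and> {u, v} \<in> edges G. f v * (f v - f u))"
    by (subst (asm) sum_adjacent_swap[OF assms])
  ultimately have "?S + ?S = (\<Sum>u\<in>verts G. \<Sum>v | v \<in> verts G \<and> {u, v} \<in> edges G.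
      f u * (f u - f v) + f v * (f v - f u))" by (simp add: sum.distrib)
  also have "\<dots> = 2 * dirichlet_form G f"
    by (simp add: dirichlet_form_def power2_eq_square algebra_simps)
  finally show ?thesis by simp
qed

section \<open>Laplacian matrix and Laplacian operator\<close>

lemma vertex_list:
  assumes "finite (verts G)"
  shows "distinct (vertex_list G)" "set (vertex_list G) = verts G"
proof -
  have "\<exists>vs. distinct vs \<and> set vs = verts G" using finite_distinct_list[OF assms] by blast
  from someI_ex[OF this] show "distinct (vertex_list G)" "set (vertex_list G) = verts G"
    unfolding vertex_list_def by auto
qed

lemma sum_vertex_list:
  fixes \<phi> :: "'a \<Rightarrow> 'b :: comm_monoid_add"
  assumes "finite (verts G)"
  shows "(\<Sum>v\<in>verts G. \<phi> v) = (\<Sum>j<length (vertex_list G). \<phi> (vertex_list G ! j))"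
  using vertex_list[OF assms] by (intro sum.reindex_bij_betw[symmetric] bij_betw_nth) auto

lemma dim_laplacian_matrix [simp]:
  "dim_row (laplacian_matrix G) = length (vertex_list G)"
  "dim_col (laplacian_matrix G) = length (vertex_list G)"
  by (auto simp: laplacian_matrix_def Let_def)

text \<open>The matrix is degree minus adjacency. Loop-freeness enters on the diagonal, where the
  entry is the full degree without an adjacency correction.\<close>

lemma laplacian_matrix_row:
  assumes fin: "finite (verts G)" and loopfree: "\<And>u. {u} \<notin> edges G"
    and i: "i < length (vertex_list G)"
  shows "(\<Sum>j<length (vertex_list G). laplacian_matrix G $$ (i, j) * f (vertex_list G ! j)) =
    graph_laplacian G f (vertex_list G ! i)"
proof -
  define vs where "vs = vertex_list G"
  define e :: "nat \<Rightarrow> real" where "e j = (if {vs ! i, vs ! j} \<in> edges G then 1 else 0)" for j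
  have "real (vertex_degree G (vs ! i)) = (\<Sum>v\<in>verts G. if {vs ! i, v} \<in> edges G then 1 else 0)"
    using fin by (simp add: vertex_degree_def sum.If_cases Int_def)
  also have "\<dots> = (\<Sum>j<length vs. e j)"
    unfolding sum_vertex_list[OF fin] vs_def e_def ..
  finally have deg: "real (vertex_degree G (vs ! i)) = (\<Sum>j<length vs. e j)" .
  have entry: "laplacian_matrix G $$ (i, j) = (if i = j then real (vertex_degree G (vs ! i)) else 0) - e j"
    if "j < length vs" for j
    using i that loopfree by (auto simp: laplacian_matrix_def Let_def e_def vs_def)
  have "(\<Sum>j<length vs. laplacian_matrix G $$ (i, j) * f (vs ! j)) =
      (\<Sum>j<length vs. (if i = j then real (vertex_degree G (vs ! i)) * f (vs ! i) else 0) - e j * f (vs ! j))"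
    by (intro sum.cong refl) (auto simp: entry algebra_simps)
  also have "\<dots> = (\<Sum>j<length vs. e j * (f (vs ! i) - f (vs ! j)))"
    using i by (simp add: sum_subtractf vs_def[symmetric] deg sum_distrib_right right_diff_distrib)
  also have "\<dots> = (\<Sum>v\<in>verts G. (if {vs ! i, v} \<in> edges G then f (vs ! i) - f v else 0))"
    unfolding sum_vertex_list[OF fin] vs_def[symmetric] by (intro sum.cong) (auto simp: e_def)
  also have "\<dots> = graph_laplacian G f (vs ! i)"
    using fin by (simp add: graph_laplacian_def sum.If_cases Int_def)
  finally show ?thesis by (simp add: vs_def)
qed

lemma distinct_list_interpolate:
  assumes "distinct vs"
  obtains f where "\<And>j. j < length vs \<Longrightarrow> f (vs ! j) = \<phi> j"
proof
  show "(\<lambda>u. \<phi> (the_inv_into {..<length vs} ((!) vs) u)) (vs ! j) = \<phi> j" if "j < length vs" for j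
    using that assms by (subst the_inv_into_f_f) (auto simp: inj_on_nth)
qed

text \<open>An eigenvector is the list of values of an eigenfunction along
  \<open>vertex_list G\<close>, so the spectrum can be studied through functions on the
  vertices.\<close>

lemma laplacian_matrix_root_iff:
  assumes fin: "finite (verts G)" and loopfree: "\<And>u. {u} \<notin> edges G"
  shows "poly (char_poly (laplacian_matrix G)) \<mu> = 0 \<longleftrightarrow>
    (\<exists>f. (\<exists>u\<in>verts G. f u \<noteq> 0) \<and> (\<forall>u\<in>verts G. graph_laplacian G f u = \<mu> * f u))"
proof -
  define vs where "vs = vertex_list G"
  define n where "n = length vs"
  have vs: "distinct vs" "set vs = verts G" using vertex_list[OF fin] by (auto simp: vs_def)
  have L: "laplacian_matrix G \<in> carrier_mat n n" by (auto simp: n_def vs_def intro!: carrier_matI)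
  have row: "(laplacian_matrix G *\<^sub>v v) $ i = graph_laplacian G f (vs ! i)"
    if "i < n" "v \<in> carrier_vec n" "\<And>j. j < n \<Longrightarrow> f (vs ! j) = v $ j" for i v f
  proof -
    have "(laplacian_matrix G *\<^sub>v v) $ i = (\<Sum>j<n. laplacian_matrix G $$ (i, j) * f (vs ! j))"
      using that L by (auto simp: scalar_prod_def atLeast0LessThan intro!: sum.cong)
    then show ?thesis using laplacian_matrix_row[OF fin loopfree, of i f] that(1)
      by (simp add: n_def vs_def)
  qed
  show ?thesis
    unfolding eigenvalue_root_char_poly[OF L, symmetric] eigenvalue_def eigenvector_def
  proof safe
    fix v assume v: "v \<in> carrier_vec (dim_row (laplacian_matrix G))"
      "v \<noteq> 0\<^sub>v (dim_row (laplacian_matrix G))" "laplacian_matrix G *\<^sub>v v = \<mu> \<cdot>\<^sub>v v"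
    then have vn: "v \<in> carrier_vec n" "v \<noteq> 0\<^sub>v n" using L by auto
    obtain f where f: "\<And>j. j < n \<Longrightarrow> f (vs ! j) = v $ j"
      using distinct_list_interpolate[OF vs(1), of "\<lambda>j. v $ j"] unfolding n_def by blast
    from vn have "\<exists>j<n. v $ j \<noteq> 0" by (metis carrier_vecD eq_vecI index_zero_vec)
    then have "\<exists>u\<in>verts G. f u \<noteq> 0" using f vs(2) unfolding n_def by (metis nth_mem)
    moreover have "graph_laplacian G f u = \<mu> * f u" if "u \<in> verts G" for u
    proof -
      from that obtain i where i: "i < n" "u = vs ! i" using vs(2) unfolding n_def by (metis in_set_conv_nth)
      then show ?thesis using row[OF i(1) vn(1) f] v(3) vn(1) f by simp
    qed
    ultimately show "\<exists>f. (\<exists>u\<in>verts G. f u \<noteq> 0) \<and> (\<forall>u\<in>verts G. graph_laplacian G f u = \<mu> * f u)" by blast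
  next
    fix f u assume f: "\<forall>u\<in>verts G. graph_laplacian G f u = \<mu> * f u" "u \<in> verts G" "f u \<noteq> 0"
    define v where "v = vec n (\<lambda>j. f (vs ! j))"
    obtain i where i: "i < n" "u = vs ! i" using f(2) vs(2) unfolding n_def by (metis in_set_conv_nth)
    have "v \<in> carrier_vec n" by (simp add: v_def)
    moreover have "v $ i \<noteq> 0\<^sub>v n $ i" using i f by (simp add: v_def)
    then have "v \<noteq> 0\<^sub>v n" by auto
    moreover have "laplacian_matrix G *\<^sub>v v = \<mu> \<cdot>\<^sub>v v"
    proof (rule eq_vecI)
      fix j assume "j < dim_vec (\<mu> \<cdot>\<^sub>v v)"
      then have j: "j < n" by (simp add: v_def)
      then have "vs ! j \<in> verts G" using vs(2) unfolding n_def by (metis nth_mem)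
      then show "(laplacian_matrix G *\<^sub>v v) $ j = (\<mu> \<cdot>\<^sub>v v) $ j"
        using row[OF j, of v f] f(1) j by (simp add: v_def)
    qed (simp add: v_def n_def vs_def)
    ultimately show "\<exists>v. v \<in> carrier_vec (dim_row (laplacian_matrix G)) \<and>
        v \<noteq> 0\<^sub>v (dim_row (laplacian_matrix G)) \<and> laplacian_matrix G *\<^sub>v v = \<mu> \<cdot>\<^sub>v v"
      by (auto simp: n_def vs_def)
  qed
qed

section \<open>Locating the second smallest eigenvalue\<close>

text \<open>The all-ones vector spans an invariant line with eigenvalue 0, and the other factor
  belongs to the map induced on the quotient by this line. This controls algebraic multiplicities,
  on which \<open>algebraic_connectivity\<close> depends, without diagonalising the matrix.\<close>

lemma char_poly_zero_row_sums:
  fixes A :: "'a :: field mat"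
  assumes A: "A \<in> carrier_mat (Suc m) (Suc m)"
    and rows: "\<And>i. i < Suc m \<Longrightarrow> (\<Sum>j<Suc m. A $$ (i, j)) = 0"
  shows "char_poly A =
    [:0, 1:] * char_poly (mat m m (\<lambda>(i, j). A $$ (Suc i, Suc j) - A $$ (0, Suc j)))"
proof -
  let ?n = "Suc m"
  \<comment> \<open>Change to the basis in which the first unit vector is replaced by the all-ones vector.\<close>
  define P :: "'a mat" where "P = mat ?n ?n (\<lambda>(i, j). if j = 0 \<or> i = j then 1 else 0)"
  define Q :: "'a mat" where "Q = mat ?n ?n (\<lambda>(i, j). if i = j then 1 else if j = 0 then - 1 else 0)"
  define D where "D = mat m m (\<lambda>(i, j). A $$ (Suc i, Suc j) - A $$ (0, Suc j))"
  \<comment> \<open>In the new basis the first column vanishes because \<open>A\<close> annihilates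
    the all-ones vector; this makes the matrix block triangular.\<close>
  define B where "B = four_block_mat (0\<^sub>m 1 1) (mat 1 m (\<lambda>(i, j). A $$ (0, Suc j))) (0\<^sub>m m 1) D"
  have D: "D \<in> carrier_mat m m" by (simp add: D_def)
  have carr: "P \<in> carrier_mat ?n ?n" "Q \<in> carrier_mat ?n ?n" "B \<in> carrier_mat ?n ?n"
    by (auto simp: P_def Q_def B_def D_def intro!: carrier_matI)
  have B_entry: "B $$ (i, j) = (if j = 0 then 0 else if i = 0 then A $$ (0, j)
      else A $$ (i, j) - A $$ (0, j))" if "i < ?n" "j < ?n" for i j
    using that by (cases i; cases j) (auto simp: B_def D_def)
  have P_mult: "(P * X) $$ (i, j) = X $$ (0, j) + (if i = 0 then 0 else X $$ (i, j))"
    if "X \<in> carrier_mat ?n ?n" "i < ?n" "j < ?n" for X i j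
  proof -
    have "(P * X) $$ (i, j) = (\<Sum>k<?n. (if k = 0 \<or> i = k then 1 else 0) * X $$ (k, j))"
      using that carr by (auto simp: scalar_prod_def atLeast0LessThan P_def intro!: sum.cong)
    also have "\<dots> = (\<Sum>k<?n. (if k = 0 then X $$ (0, j) else 0) +
        (if k = i then if i = 0 then 0 else X $$ (i, j) else 0))"
      by (intro sum.cong) auto
    also have "\<dots> = X $$ (0, j) + (if i = 0 then 0 else X $$ (i, j))"
      using that unfolding sum.distrib sum.delta[OF finite_lessThan] by simp
    finally show ?thesis .
  qed
  have PQ: "P * Q = 1\<^sub>m ?n"
  proof (rule eq_matI)
    fix i j assume "i < dim_row (1\<^sub>m ?n :: 'a mat)" "j < dim_col (1\<^sub>m ?n :: 'a mat)"
    then have ij: "i < ?n" "j < ?n" by auto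
    then show "(P * Q) $$ (i, j) = 1\<^sub>m ?n $$ (i, j)"
      unfolding P_mult[OF carr(2) ij] by (auto simp: Q_def)
  qed (use carr in auto)
  then have QP: "Q * P = 1\<^sub>m ?n" by (rule mat_mult_left_right_inverse[OF carr(1,2)])
  have AP: "A * P = P * B"
  proof (rule eq_matI)
    fix i j assume "i < dim_row (P * B)" "j < dim_col (P * B)"
    then have ij: "i < ?n" "j < ?n" using carr by auto
    have "(A * P) $$ (i, j) = (\<Sum>k<?n. A $$ (i, k) * (if j = 0 \<or> k = j then 1 else 0))"
      using ij A carr by (auto simp: scalar_prod_def atLeast0LessThan P_def intro!: sum.cong)
    also have "\<dots> = (if j = 0 then 0 else A $$ (i, j))"
    proof (cases "j = 0")
      case True
      then show ?thesis using rows[OF ij(1)] by simp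
    next
      case False
      then have "(\<Sum>k<?n. A $$ (i, k) * (if j = 0 \<or> k = j then 1 else 0)) =
          (\<Sum>k<?n. if k = j then A $$ (i, j) else 0)" by (intro sum.cong) auto
      then show ?thesis using False ij by (simp del: sum.lessThan_Suc)
    qed
    also have "\<dots> = (P * B) $$ (i, j)"
      unfolding P_mult[OF carr(3) ij] using ij by (simp add: B_entry)
    finally show "(A * P) $$ (i, j) = (P * B) $$ (i, j)" .
  qed (use A carr in auto)
  have "A = A * (P * Q)" using A by (simp add: PQ)
  also have "\<dots> = P * B * Q" using assoc_mult_mat[OF A carr(1,2)] by (simp add: AP)
  finally have "similar_mat A B"
    using A carr PQ QP unfolding similar_mat_def similar_mat_wit_def Let_def
    by (intro exI[of _ P] exI[of _ Q]) auto
  then have "char_poly A = char_poly B" by (rule char_poly_similar)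
  also have "\<dots> = char_poly (0\<^sub>m 1 1) * char_poly D"
    unfolding B_def by (rule char_poly_four_block_zeros_col) (use D in auto)
  also have "char_poly (0\<^sub>m 1 1 :: 'a mat) = [:0, 1:]"
    by (simp add: char_poly_def char_poly_matrix_def det_single)
  finally show ?thesis by (simp add: D_def)
qed

text \<open>The Poincare inequality bounds every nonzero eigenvalue below by \<open>l\<close> and
  forces the kernel to consist of constants, so 0 is a simple root. As \<open>y\<close> realises
  \<open>l\<close>, the sorted spectrum starts with 0 and \<open>l\<close>.\<close>

lemma algebraic_connectivity_eqI:
  assumes fin: "finite (verts G)" and loopfree: "\<And>u. {u} \<notin> edges G" and pos: "0 < l"
    and poincare: "\<And>f. (\<Sum>u\<in>verts G. f u) = 0 \<Longrightarrow> l * (\<Sum>u\<in>verts G. (f u)\<^sup>2) \<le> dirichlet_form G f"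
    and eigen: "\<And>u. u \<in> verts G \<Longrightarrow> graph_laplacian G y u = l * y u"
    and y: "w \<in> verts G" "y w \<noteq> 0"
  shows "algebraic_connectivity G = l"
proof -
  define vs where "vs = vertex_list G"
  define L where "L = laplacian_matrix G"
  have vs: "distinct vs" "set vs = verts G" using vertex_list[OF fin] by (auto simp: vs_def)
  then have "length vs \<noteq> 0" using y by auto
  then obtain m where m: "length vs = Suc m" by (cases "length vs") auto
  have L: "L \<in> carrier_mat (Suc m) (Suc m)"
    unfolding L_def by (intro carrier_matI) (use m in \<open>auto simp: vs_def\<close>)
  have row: "(\<Sum>j<Suc m. L $$ (i, j) * f (vs ! j)) = graph_laplacian G f (vs ! i)" if "i < Suc m" for i f
    using laplacian_matrix_row[OF fin loopfree, of i f] that m by (simp add: L_def vs_def)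
  define D where "D = mat m m (\<lambda>(i, j). L $$ (Suc i, Suc j) - L $$ (0, Suc j))"
  have D: "D \<in> carrier_mat m m" by (simp add: D_def)
  have fact: "char_poly L = [:0, 1:] * char_poly D"
    unfolding D_def
  proof (rule char_poly_zero_row_sums[OF L])
    fix i assume "i < Suc m"
    from row[OF this, of "\<lambda>_. 1"] show "(\<Sum>j<Suc m. L $$ (i, j)) = 0"
      by (simp add: graph_laplacian_def)
  qed
  have D0: "char_poly D \<noteq> 0" using degree_monic_char_poly[OF D] by auto
  have root: "l \<le> \<mu>" if rt: "poly (char_poly L) \<mu> = 0" and nz: "\<mu> \<noteq> 0" for \<mu>
  proof -
    obtain f u where u: "u \<in> verts G" "f u \<noteq> 0" and f: "\<And>u. u \<in> verts G \<Longrightarrow> graph_laplacian G f u = \<mu> * f u"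
      using rt unfolding L_def laplacian_matrix_root_iff[OF fin loopfree] by blast
    \<comment> \<open>An eigenfunction with nonzero eigenvalue has mean zero, so the Poincare
      inequality applies to it.\<close>
    have "\<mu> * (\<Sum>u\<in>verts G. f u) = (\<Sum>u\<in>verts G. graph_laplacian G f u)"
      unfolding sum_distrib_left by (intro sum.cong) (auto simp: f)
    then have "(\<Sum>u\<in>verts G. f u) = 0" using nz sum_graph_laplacian[OF fin, of f] by simp
    then have "l * (\<Sum>u\<in>verts G. (f u)\<^sup>2) \<le> dirichlet_form G f" by (rule poincare)
    also have "\<dots> = (\<Sum>u\<in>verts G. f u * graph_laplacian G f u)"
      by (rule sum_mult_graph_laplacian[OF fin, symmetric])
    also have "\<dots> = \<mu> * (\<Sum>u\<in>verts G. (f u)\<^sup>2)"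
      unfolding sum_distrib_left by (intro sum.cong) (auto simp: f power2_eq_square)
    finally have "l * (\<Sum>u\<in>verts G. (f u)\<^sup>2) \<le> \<mu> * (\<Sum>u\<in>verts G. (f u)\<^sup>2)" .
    moreover have "0 < (\<Sum>u\<in>verts G. (f u)\<^sup>2)"
      using fin u by (intro sum_pos2[of _ u]) auto
    ultimately show ?thesis by simp
  qed
  \<comment> \<open>Simplicity of the root 0. A kernel vector of \<open>D\<close> is lifted to a
    function that vanishes at the first vertex and has constant Laplacian. The constant is 0 since
    Laplacians sum to 0; the Poincare inequality for the function minus its mean \<open>a\<close>
    then makes it constant, hence zero.\<close>
  have ker: "poly (char_poly D) 0 \<noteq> 0"
  proof
    assume "poly (char_poly D) 0 = 0"
    then obtain z where z: "z \<in> carrier_vec m" "z \<noteq> 0\<^sub>v m" "D *\<^sub>v z = 0 \<cdot>\<^sub>v z"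
      unfolding eigenvalue_root_char_poly[OF D, symmetric] eigenvalue_def eigenvector_def
      using D by auto
    obtain f where f: "\<And>j. j < Suc m \<Longrightarrow> f (vs ! j) = (case j of 0 \<Rightarrow> 0 | Suc i \<Rightarrow> z $ i)"
      using distinct_list_interpolate[OF vs(1), of "case_nat 0 (\<lambda>i. z $ i)"] unfolding m by blast
    have lap: "graph_laplacian G f (vs ! i) = (\<Sum>j<m. L $$ (i, Suc j) * z $ j)" if "i < Suc m" for i
      unfolding row[OF that, symmetric] by (subst sum.lessThan_Suc_shift) (simp add: f)
    define c where "c = graph_laplacian G f (vs ! 0)"
    have const: "graph_laplacian G f (vs ! i) = c" if "i < Suc m" for i
    proof (cases i)
      case (Suc j)
      then have j: "j < m" using that by simp
      have "graph_laplacian G f (vs ! i) - c = (\<Sum>k<m. (L $$ (i, Suc k) - L $$ (0, Suc k)) * z $ k)"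
        using that by (simp add: c_def lap sum_subtractf left_diff_distrib)
      also have "\<dots> = (D *\<^sub>v z) $ j"
        using j z(1) Suc by (auto simp: D_def scalar_prod_def atLeast0LessThan intro!: sum.cong)
      also have "\<dots> = 0" using z(1,3) j by simp
      finally show ?thesis by simp
    qed (simp add: c_def)
    have "(\<Sum>u\<in>verts G. graph_laplacian G f u) = (\<Sum>j<Suc m. c)"
      unfolding sum_vertex_list[OF fin] vs_def[symmetric] m by (intro sum.cong) (auto simp: const)
    then have "c = 0" using sum_graph_laplacian[OF fin, of f] by simp
    then have lap0: "graph_laplacian G f u = 0" if "u \<in> verts G" for u
      using const that vs m by (metis in_set_conv_nth)
    define a where "a = (\<Sum>u\<in>verts G. f u) / card (verts G)"
    have "card (verts G) \<noteq> 0" using fin y by auto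
    then have "(\<Sum>u\<in>verts G. f u - a) = 0" by (simp add: a_def sum_subtractf)
    then have "l * (\<Sum>u\<in>verts G. (f u - a)\<^sup>2) \<le> dirichlet_form G (\<lambda>u. f u - a)" by (rule poincare)
    also have "\<dots> = dirichlet_form G f" by (simp add: dirichlet_form_def)
    also have "\<dots> = 0" by (simp add: lap0 flip: sum_mult_graph_laplacian[OF fin])
    finally have "(\<Sum>u\<in>verts G. (f u - a)\<^sup>2) \<le> 0" using pos by (simp add: mult_le_0_iff)
    then have "(\<Sum>u\<in>verts G. (f u - a)\<^sup>2) = 0" by (intro antisym sum_nonneg) auto
    then have fa: "f u = a" if "u \<in> verts G" for u using fin that by (simp add: sum_nonneg_eq_0_iff)
    have vsV: "vs ! j \<in> verts G" if "j < Suc m" for j using that vs m by (metis nth_mem)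
    have "a = 0" using fa[OF vsV[of 0]] f[of 0] by simp
    then have "z $ j = 0" if "j < m" for j using fa[OF vsV[of "Suc j"]] f[of "Suc j"] that by simp
    then have "z = 0\<^sub>v m" using z(1) by (intro eq_vecI) auto
    then show False using z(2) by simp
  qed
  have "poly (char_poly L) l = 0"
    unfolding L_def laplacian_matrix_root_iff[OF fin loopfree] using eigen y by blast
  then have "poly (char_poly D) l = 0" using pos by (simp add: fact)
  then have "l \<in># proots (char_poly D)" using D0 by simp
  then obtain M where M: "proots (char_poly D) = add_mset l M" by (metis mset_add)
  have ge: "l \<le> \<mu>" if "\<mu> \<in># proots (char_poly D)" for \<mu>
  proof (rule root)
    have "poly (char_poly D) \<mu> = 0" using that D0 by simp
    then show "poly (char_poly L) \<mu> = 0" "\<mu> \<noteq> 0" using ker by (auto simp: fact)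
  qed
  have "sorted_list_of_multiset (proots (char_poly D)) = l # sorted_list_of_multiset M"
    using ge unfolding M by (simp add: insort_is_Cons)
  moreover have "proots (char_poly L) = add_mset 0 (proots (char_poly D))"
    unfolding fact using D0 by (subst proots_mult) auto
  then have "sorted_list_of_multiset (proots (char_poly L)) =
      0 # sorted_list_of_multiset (proots (char_poly D))"
    using ge pos by (simp add: insort_is_Cons order.trans[of 0 l])
  ultimately show ?thesis by (simp add: algebraic_connectivity_def L_def)
qed

section \<open>Fourier analysis on a cycle\<close>

lemma sum_shift_periodic:
  fixes \<phi> :: "nat \<Rightarrow> 'a :: ab_group_add"
  assumes "\<And>a. \<phi> (a + n) = \<phi> a"
  shows "(\<Sum>a<n. \<phi> (a + k)) = (\<Sum>a<n. \<phi> a)"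
proof (induction k)
  case (Suc k)
  have "\<phi> k + (\<Sum>a<n. \<phi> (Suc a + k)) = (\<Sum>a<Suc n. \<phi> (a + k))"
    by (subst sum.lessThan_Suc_shift) simp
  also have "\<dots> = (\<Sum>a<n. \<phi> (a + k)) + \<phi> k"
    using assms[of k] by (simp add: add.commute)
  finally show ?case using Suc by simp
qed simp

text \<open>Cosine decreases on the first half period; points beyond \<open>pi\<close> are reflected
  to \<open>2 * pi - x\<close>.\<close>

lemma cos_le_cos_away:
  assumes "0 \<le> t" "t \<le> pi" "t \<le> x" "x \<le> 2 * pi - t"
  shows "cos x \<le> cos t"
proof (cases "x \<le> pi")
  case True
  then show ?thesis using assms by (intro cos_monotone_0_pi_le) auto
next
  case False
  have "cos x = cos (2 * pi - x)" by simp
  also have "\<dots> \<le> cos t" using False assms by (intro cos_monotone_0_pi_le) auto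
  finally show ?thesis .
qed

text \<open>For \<open>a \<noteq> b\<close> this is a geometric series whose ratio is an
  \<open>n\<close>-th root of unity, different from 1 because \<open>n\<close> cannot divide a
  nonzero difference of absolute value below \<open>n\<close>.\<close>

lemma sum_roots_of_unity:
  fixes a b n :: nat
  assumes "a < n" "b < n"
  shows "(\<Sum>r<n. cis (2 * pi * real r * (real b - real a) / real n)) =
    (if a = b then of_nat n else 0)"
proof (cases "a = b")
  case False
  define z where "z = cis (2 * pi * (real b - real a) / real n)"
  have n: "real n > 0" using assms by auto
  have pow: "cis (2 * pi * real r * (real b - real a) / real n) = z ^ r" for r
    unfolding z_def DeMoivre by (rule arg_cong[of _ _ cis]) (simp add: field_simps)
  have "z ^ n = cis (2 * pi * real_of_int (int b - int a))"
    unfolding z_def DeMoivre using n by simp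
  also have "\<dots> = 1" by (rule cis_multiple_2pi) auto
  finally have zn: "z ^ n = 1" .
  have "z \<noteq> 1"
  proof
    assume "z = 1"
    then have "cos (2 * pi * (real b - real a) / real n) = 1"
      unfolding z_def by (metis Re_complex_of_real cis.simps(1) of_real_1)
    then obtain k :: int where "2 * pi * (real b - real a) / real n = of_int k * 2 * pi"
      using cos_one_2pi_int by auto
    then have "2 * pi * (real b - real a) = 2 * pi * (of_int k * real n)"
      using n by (simp add: field_simps)
    then have "real b - real a = of_int k * real n"
      unfolding mult_cancel_left by simp
    then have "real_of_int (int b - int a) = real_of_int (k * int n)" by simp
    then have eq: "int b - int a = k * int n" by (simp only: of_int_eq_iff)
    have "int n dvd int b - int a" using eq by simp
    moreover have "\<bar>int b - int a\<bar> < int n" using assms by auto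
    ultimately show False using False zdvd_imp_le[of "int n" "\<bar>int b - int a\<bar>"] by auto
  qed
  then show ?thesis using False zn by (simp add: pow geometric_sum)
qed auto

text \<open>The transform carries no normalising factor, which is where the factor
  \<open>real n\<close> in \<open>parseval\<close> comes from.\<close>

definition dft :: "nat \<Rightarrow> (nat \<Rightarrow> real) \<Rightarrow> nat \<Rightarrow> complex" where
  "dft n x r = (\<Sum>a<n. of_real (x a) * cis (- (2 * pi * real r * real a / real n)))"

lemma dft_diff: "dft n (\<lambda>a. x a - y a) r = dft n x r - dft n y r"
  by (simp add: dft_def sum_subtractf algebra_simps)

text \<open>The summand \<open>\<phi>\<close> is itself \<open>n\<close>-periodic, so the summation
  index can be shifted by \<open>k\<close> at the price of a phase.\<close>

lemma dft_shift:
  assumes "n > 0" "\<And>a. x (a + n) = x a"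
  shows "dft n (\<lambda>a. x (a + k)) r = cis (2 * pi * real r * real k / real n) * dft n x r"
proof -
  define \<phi> where "\<phi> a = complex_of_real (x a) * cis (- (2 * pi * real r * real a / real n))" for a
  have "\<phi> (a + n) = \<phi> a" for a
  proof -
    have "cis (- (2 * pi * real r * real (a + n) / real n)) =
        cis (- (2 * pi * real r * real a / real n)) * cis (2 * pi * (- real r))"
      unfolding cis_mult using assms(1) by (intro arg_cong[of _ _ cis]) (simp add: field_simps)
    also have "cis (2 * pi * (- real r)) = 1" by (rule cis_multiple_2pi) auto
    finally show ?thesis by (simp add: \<phi>_def assms(2))
  qed
  then have "(\<Sum>a<n. \<phi> (a + k)) = (\<Sum>a<n. \<phi> a)" by (rule sum_shift_periodic)
  moreover have "of_real (x (a + k)) * cis (- (2 * pi * real r * real a / real n)) =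
      cis (2 * pi * real r * real k / real n) * \<phi> (a + k)" for a
  proof -
    have "cis (2 * pi * real r * real k / real n) * cis (- (2 * pi * real r * real (a + k) / real n))
        = cis (- (2 * pi * real r * real a / real n))"
      unfolding cis_mult by (intro arg_cong[of _ _ cis]) (simp add: distrib_left add_divide_distrib)
    then show ?thesis by (simp add: \<phi>_def mult.left_commute)
  qed
  ultimately show ?thesis
    by (simp add: dft_def flip: sum_distrib_left) (simp add: \<phi>_def)
qed

text \<open>Expand the squared modulus as a double sum and sum over the modes first: orthogonality
  leaves only the diagonal terms.\<close>

lemma parseval:
  "(\<Sum>r<n. (cmod (dft n x r))\<^sup>2) = real n * (\<Sum>a<n. (x a)\<^sup>2)"
proof -
  have "complex_of_real ((cmod (dft n x r))\<^sup>2) = (\<Sum>a<n. \<Sum>b<n. of_real (x a * x b) *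
      cis (2 * pi * real r * (real b - real a) / real n))" for r
  proof -
    have "complex_of_real ((cmod (dft n x r))\<^sup>2) = dft n x r * cnj (dft n x r)"
      by (metis complex_norm_square of_real_power)
    also have "\<dots> = (\<Sum>a<n. \<Sum>b<n. of_real (x a * x b) *
        (cis (- (2 * pi * real r * real a / real n)) * cis (2 * pi * real r * real b / real n)))"
      unfolding dft_def cnj_sum sum_product by (simp add: cis_cnj mult_ac)
    finally show ?thesis
      by (simp add: cis_mult right_diff_distrib diff_divide_distrib)
  qed
  then have "complex_of_real (\<Sum>r<n. (cmod (dft n x r))\<^sup>2) =
      (\<Sum>r<n. \<Sum>a<n. \<Sum>b<n. of_real (x a * x b) *
        cis (2 * pi * real r * (real b - real a) / real n))" by simp
  also have "\<dots> = (\<Sum>a<n. \<Sum>r<n. \<Sum>b<n. of_real (x a * x b) *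
        cis (2 * pi * real r * (real b - real a) / real n))" by (rule sum.swap)
  also have "\<dots> = (\<Sum>a<n. \<Sum>b<n. \<Sum>r<n. of_real (x a * x b) *
        cis (2 * pi * real r * (real b - real a) / real n))"
    by (intro sum.cong refl sum.swap)
  also have "\<dots> = (\<Sum>a<n. \<Sum>b<n. of_real (x a * x b) * (if a = b then of_nat n else 0))"
    by (intro sum.cong refl) (simp add: sum_roots_of_unity flip: sum_distrib_left)
  also have "\<dots> = complex_of_real (real n * (\<Sum>a<n. (x a)\<^sup>2))"
    by (simp add: if_distrib sum_distrib_left power2_eq_square mult_ac cong: if_cong)
  finally show ?thesis by (simp only: of_real_eq_iff)
qed

lemma dft_0: "dft n x 0 = of_real (\<Sum>a<n. x a)"
  by (simp add: dft_def)

lemma cmod_cis_minus_1: "(cmod (cis t - 1))\<^sup>2 = 2 - 2 * cos t"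
  using sin_cos_squared_add[of t] unfolding cmod_power2
  by (simp add: power2_eq_square algebra_simps)

lemma cycle_poincare:
  fixes x :: "nat \<Rightarrow> real"
  assumes n: "n \<ge> 2" and per: "\<And>a. x (a + n) = x a" and sum0: "(\<Sum>a<n. x a) = 0"
  shows "(2 - 2 * cos (2 * pi / real n)) * (\<Sum>a<n. (x a)\<^sup>2) \<le> (\<Sum>a<n. (x (a + 1) - x a)\<^sup>2)"
proof -
  have "(2 - 2 * cos (2 * pi / real n)) * (cmod (dft n x r))\<^sup>2
      \<le> (cmod (dft n (\<lambda>a. x (a + 1) - x a) r))\<^sup>2" if "r < n" for r
  proof (cases "r = 0")
    case True
    then show ?thesis by (simp add: dft_0 sum0)
  next
    case False
    define t where "t = 2 * pi * real r / real n"
    have "dft n (\<lambda>a. x (a + 1) - x a) r = (cis t - 1) * dft n x r"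
      using n dft_shift[of n x 1 r] per by (simp add: dft_diff t_def algebra_simps)
    then have eq: "(cmod (dft n (\<lambda>a. x (a + 1) - x a) r))\<^sup>2 = (2 - 2 * cos t) * (cmod (dft n x r))\<^sup>2"
      by (simp add: norm_mult power_mult_distrib cmod_cis_minus_1)
    have "real r + 1 \<le> real n" using that by linarith
    then have "2 * pi * (real r + 1) \<le> 2 * pi * real n" by (intro mult_left_mono) auto
    then have "cos t \<le> cos (2 * pi / real n)"
      unfolding t_def using n False by (intro cos_le_cos_away) (auto simp: field_simps)
    then show ?thesis unfolding eq by (intro mult_right_mono) auto
  qed
  then have "(\<Sum>r<n. (2 - 2 * cos (2 * pi / real n)) * (cmod (dft n x r))\<^sup>2)
      \<le> (\<Sum>r<n. (cmod (dft n (\<lambda>a. x (a + 1) - x a) r))\<^sup>2)" by (intro sum_mono) auto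
  then have "real n * ((2 - 2 * cos (2 * pi / real n)) * (\<Sum>a<n. (x a)\<^sup>2))
      \<le> real n * (\<Sum>a<n. (x (a + 1) - x a)\<^sup>2)"
    unfolding parseval sum_distrib_left[symmetric] by (simp add: mult_ac)
  then show ?thesis using n by simp
qed

section \<open>Two tokens on a cycle\<close>

text \<open>Fourier mode \<open>r\<close> in the centre of mass of two tokens on the \<open>n\<close>-cycle leaves the form
  \<open>path_form n (cos (pi * r / n))\<close> in their distance \<open>d\<close>, restricted to functions of parity
  \<open>(-1) ^ r\<close> under \<open>d \<mapsto> n - d\<close>.\<close>

definition path_form :: "nat \<Rightarrow> real \<Rightarrow> (nat \<Rightarrow> real) \<Rightarrow> real" where
  "path_form n c g = (\<Sum>d\<in>{1..<n-1}. 2 * (g d)\<^sup>2 + 2 * (g (d + 1))\<^sup>2 - 4 * c * g d * g (d + 1))"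

text \<open>AM-GM on each edge of the path; every vertex lies on at least one edge. Only the last
  vertex \<open>n - 1\<close> is not the left end of an edge and is charged to the edge before
  it.\<close>

lemma path_form_ge_bulk:
  assumes n: "n \<ge> 3" and c: "\<bar>c\<bar> \<le> c'" and c': "c' \<le> 1"
  shows "(2 - 2 * c') * (\<Sum>d\<in>{1..<n}. (g d)\<^sup>2) \<le> path_form n c g"
proof -
  have "(\<Sum>d\<in>{1..<n}. (g d)\<^sup>2) = (\<Sum>d\<in>{1..<n-1}. (g d)\<^sup>2) + (g (n - 1))\<^sup>2"
    using n sum.atLeastLessThan_Suc[of 1 "n - 1" "\<lambda>d. (g d)\<^sup>2"] by simp
  also have "(g (n - 1))\<^sup>2 = (g (n - 2 + 1))\<^sup>2" using n by (simp add: numeral_2_eq_2 Suc_diff_Suc)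
  also have "\<dots> \<le> (\<Sum>d\<in>{1..<n-1}. (g (d + 1))\<^sup>2)"
    using n by (intro member_le_sum[of "n - 2" _ "\<lambda>d. (g (d + 1))\<^sup>2"]) auto
  finally have "(2 - 2 * c') * (\<Sum>d\<in>{1..<n}. (g d)\<^sup>2)
      \<le> (2 - 2 * c') * (\<Sum>d\<in>{1..<n-1}. (g d)\<^sup>2 + (g (d + 1))\<^sup>2)"
    using c' by (intro mult_left_mono) (auto simp: sum.distrib)
  also have "\<dots> \<le> path_form n c g"
    unfolding path_form_def sum_distrib_left
  proof (intro sum_mono)
    fix d
    have 1: "2 * (c * (g d * g (d + 1))) \<le> 2 * \<bar>c\<bar> * \<bar>g d * g (d + 1)\<bar>"
      by (metis abs_ge_self abs_mult mult.assoc mult_left_mono zero_le_numeral)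
    have "2 * \<bar>g d * g (d + 1)\<bar> \<le> (g d)\<^sup>2 + (g (d + 1))\<^sup>2"
      using sum_squares_bound[of "\<bar>g d\<bar>" "\<bar>g (d+1)\<bar>"] by (simp add: abs_mult)
    then have "\<bar>c\<bar> * (2 * \<bar>g d * g (d + 1)\<bar>) \<le> c' * ((g d)\<^sup>2 + (g (d + 1))\<^sup>2)"
      using c by (intro mult_mono) auto
    with 1 show "(2 - 2 * c') * ((g d)\<^sup>2 + (g (d + 1))\<^sup>2)
        \<le> 2 * (g d)\<^sup>2 + 2 * (g (d + 1))\<^sup>2 - 4 * c * g d * g (d + 1)"
      by (simp add: algebra_simps)
  qed
  finally show ?thesis .
qed

text \<open>Ground state substitution with \<open>cos (pi * d / n)\<close>, for which equality
  holds. Each edge term is bounded below by \<open>p d - q (d + 1)\<close>, and regrouping by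
  vertices gives exactly the required multiple of \<open>(g d)\<^sup>2\<close>.\<close>

lemma path_form_ge_antisym:
  assumes n: "n \<ge> 3" and anti: "\<And>d. 1 \<le> d \<Longrightarrow> d < n \<Longrightarrow> g (n - d) = - g d"
  shows "(2 - 2 * cos (2 * pi / real n)) * (\<Sum>d\<in>{1..<n}. (g d)\<^sup>2) \<le> path_form n (cos (pi / real n)) g"
proof -
  define \<theta> where "\<theta> = pi / real n"
  define c where "c d = cos (real d * \<theta>)" for d
  define s where "s d = sin (real d * \<theta>)" for d
  have \<theta>: "0 < \<theta>" "\<theta> < pi / 2" "real n * \<theta> = pi"
    using n by (auto simp: \<theta>_def field_simps)
  have cpos: "0 < c d" if "2 * d < n" for d
  proof -
    have "real (2 * d) * \<theta> < real n * \<theta>" using that \<theta> by (intro mult_strict_right_mono) auto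
    then show ?thesis unfolding c_def using \<theta> by (intro cos_gt_zero_pi) (auto intro: less_le_trans[of _ 0])
  qed
  have crefl: "c (n - d) = - c d" if "d < n" for d
    unfolding c_def using that \<theta> by (simp add: of_nat_diff left_diff_distrib)
  have cneg: "c d < 0" if "n < 2 * d" "d < n" for d
    using cpos[of "n - d"] crefl[of d] that by auto
  \<comment> \<open>The weight vanishes only at the midpoint \<open>n / 2\<close>, which the
    reflection fixes, so antisymmetry makes \<open>g\<close> vanish there too.\<close>
  have c0: "c d = 0 \<Longrightarrow> 1 \<le> d \<Longrightarrow> d < n \<Longrightarrow> g d = 0" for d
  proof -
    assume "c d = 0" "1 \<le> d" "d < n"
    then have "2 * d = n" using cpos[of d] cneg[of d] by (cases "2 * d" n rule: linorder_cases) auto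
    then have "n - d = d" by simp
    then show "g d = 0" using anti[of d] \<open>1 \<le> d\<close> \<open>d < n\<close> by simp
  qed
  \<comment> \<open>The mode \<open>c\<close> is the ground state of the antisymmetric sector: AM-GM weighted by it loses
    nothing. Division by a vanishing \<open>c d\<close> is harmless since then \<open>g d = 0\<close>.\<close>
  have amgm: "2 * g d * g (d + 1) \<le> c (d + 1) / c d * (g d)\<^sup>2 + c d / c (d + 1) * (g (d + 1))\<^sup>2"
    if d: "d \<in> {1..<n-1}" for d
  proof -
    \<comment> \<open>If the weights at both ends have the same sign, the inequality is a square
      divided by their positive product.\<close>
    have pos: ?thesis if "0 < c d * c (d + 1)"
    proof -
      have nz: "c d \<noteq> 0" "c (d + 1) \<noteq> 0" using that by auto
      have "0 \<le> (c (d + 1) * g d - c d * g (d + 1))\<^sup>2 / (c d * c (d + 1))"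
        using that by (intro divide_nonneg_pos) auto
      also have "\<dots> = c (d + 1) / c d * (g d)\<^sup>2 + c d / c (d + 1) * (g (d + 1))\<^sup>2 - 2 * g d * g (d + 1)"
        using nz by (simp add: field_simps power2_eq_square)
      finally show ?thesis by simp
    qed
    \<comment> \<open>Position of the edge relative to the midpoint. In the last case the edge
      straddles it and the weights have opposite signs, but antisymmetry gives
      \<open>g (d + 1) = - g d\<close> and thus equality.\<close>
    consider "2 * (d + 1) < n" | "n < 2 * d" | "2 * d = n" | "2 * (d + 1) = n" | "2 * d + 1 = n"
    proof -
      have "2 * (d + 1) < n \<or> n < 2 * d \<or> 2 * d = n \<or> 2 * (d + 1) = n \<or> 2 * d + 1 = n" by presburger
      then show ?thesis using that by blast
    qed
    then show ?thesis
    proof cases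
      case 1
      then show ?thesis using cpos[of d] cpos[of "d + 1"] by (intro pos) auto
    next
      case 2
      then show ?thesis using cneg[of d] cneg[of "d + 1"] d by (intro pos mult_neg_neg) auto
    next
      case 3
      then have "n - d = d" by simp
      then have "c d = 0" "g d = 0" using crefl[of d] anti[of d] d by auto
      then show ?thesis by simp
    next
      case 4
      then have "n - (d + 1) = d + 1" by simp
      then have "c (d + 1) = 0" "g (d + 1) = 0" using crefl[of "d + 1"] anti[of "d + 1"] d by auto
      then show ?thesis by simp
    next
      case 5
      then have "n - d = d + 1" by simp
      then have "c (d + 1) = - c d" "g (d + 1) = - g d" using crefl[of d] anti[of d] d by auto
      moreover have "c d \<noteq> 0" using cpos[of d] 5 by auto
      ultimately show ?thesis by (simp add: power2_eq_square)
    qed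
  qed
  \<comment> \<open>The share of vertex \<open>d\<close> is \<open>p d\<close> in the edge to its
    right and \<open>- q d\<close> in the edge to its left; the addition formulas rewrite the weight
    quotients in terms of sines.\<close>
  define p where "p d = 2 * sin \<theta> * s (d + 1) / c d * (g d)\<^sup>2" for d
  define q where "q d = 2 * sin \<theta> * s (d - 1) / c d * (g d)\<^sup>2" for d
  have cos\<theta>: "0 < cos \<theta>" using \<theta> by (intro cos_gt_zero_pi) auto
  have edge: "p d - q (d + 1) \<le> 2 * (g d)\<^sup>2 + 2 * (g (d + 1))\<^sup>2 - 4 * cos \<theta> * g d * g (d + 1)"
    if d: "d \<in> {1..<n-1}" for d
  proof -
    have "c d = cos (real (d + 1) * \<theta> - \<theta>)" by (simp add: c_def algebra_simps)
    then have 1: "c d - cos \<theta> * c (d + 1) = sin \<theta> * s (d + 1)"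
      by (simp add: cos_diff c_def s_def del: of_nat_add)
    have "c (d + 1) = cos (real d * \<theta> + \<theta>)" by (simp add: c_def algebra_simps)
    then have 2: "c (d + 1) - cos \<theta> * c d = - sin \<theta> * s d"
      by (simp add: cos_add c_def s_def)
    have "p d = 2 * (g d)\<^sup>2 - 2 * cos \<theta> * (c (d + 1) / c d * (g d)\<^sup>2)"
    proof (cases "c d = 0")
      case True
      then show ?thesis using c0[of d] d by (auto simp: p_def)
    next
      case False
      then show ?thesis using 1 unfolding p_def by (simp add: field_simps)
    qed
    moreover have "- q (d + 1) = 2 * (g (d + 1))\<^sup>2 - 2 * cos \<theta> * (c d / c (d + 1) * (g (d + 1))\<^sup>2)"
    proof (cases "c (d + 1) = 0")
      case True
      then show ?thesis using c0[of "d + 1"] d by (auto simp: q_def)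
    next
      case False
      then have "- q (d + 1) = 2 * (- sin \<theta> * s d) / c (d + 1) * (g (d + 1))\<^sup>2"
        by (simp add: q_def)
      also have "\<dots> = 2 * (g (d + 1))\<^sup>2 - 2 * cos \<theta> * (c d / c (d + 1) * (g (d + 1))\<^sup>2)"
        using False unfolding 2[symmetric] by (simp add: field_simps)
      finally show ?thesis .
    qed
    moreover have "2 * cos \<theta> * (2 * g d * g (d + 1)) \<le> 2 * cos \<theta> *
        (c (d + 1) / c d * (g d)\<^sup>2 + c d / c (d + 1) * (g (d + 1))\<^sup>2)"
      using amgm[OF d] cos\<theta> by (intro mult_left_mono) auto
    ultimately show ?thesis by (simp add: algebra_simps)
  qed
  \<comment> \<open>No boundary terms arise at the ends of the path: \<open>s\<close> is zero at
    both 0 and \<open>n\<close>.\<close>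
  have pn: "p (n - 1) = 0" using n \<theta> by (simp add: p_def s_def)
  have q1: "q 1 = 0" by (simp add: q_def s_def)
  have "(\<Sum>d\<in>{1..<n}. p d) = (\<Sum>d\<in>{1..<n-1}. p d)"
    using n pn sum.atLeastLessThan_Suc[of 1 "n - 1" p] by simp
  moreover have "(\<Sum>d\<in>{1..<n}. q d) = (\<Sum>d\<in>{2..<n}. q d)"
    using n q1 sum.atLeast_Suc_lessThan[of 1 n q] by (simp add: numeral_2_eq_2)
  moreover have "(\<Sum>d\<in>{2..<n}. q d) = (\<Sum>d\<in>{1..<n-1}. q (d + 1))"
    by (rule sum.reindex_bij_witness[of _ "\<lambda>d. d + 1" "\<lambda>d. d - 1"]) auto
  ultimately have "(\<Sum>d\<in>{1..<n}. p d - q d) = (\<Sum>d\<in>{1..<n-1}. p d - q (d + 1))"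
    by (simp add: sum_subtractf)
  also have "\<dots> \<le> path_form n (cos \<theta>) g"
    unfolding path_form_def by (intro sum_mono edge)
  also have "(\<Sum>d\<in>{1..<n}. p d - q d) = (\<Sum>d\<in>{1..<n}. (2 - 2 * cos (2 * \<theta>)) * (g d)\<^sup>2)"
  proof (intro sum.cong refl)
    fix d assume d: "d \<in> {1..<n}"
    have "s (d + 1) - s (d - 1) = sin (real d * \<theta> + \<theta>) - sin (real d * \<theta> - \<theta>)"
      using d by (simp add: s_def of_nat_diff algebra_simps)
    also have "\<dots> = 2 * sin \<theta> * c d" by (simp add: sin_add sin_diff c_def)
    finally have sd: "s (d + 1) - s (d - 1) = 2 * sin \<theta> * c d" .
    have "p d - q d = 2 * sin \<theta> * (s (d + 1) - s (d - 1)) / c d * (g d)\<^sup>2"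
      by (simp add: p_def q_def algebra_simps diff_divide_distrib)
    also have "\<dots> = 4 * (sin \<theta>)\<^sup>2 * (g d)\<^sup>2"
      unfolding sd using c0[of d] d by (cases "c d = 0") (auto simp: power2_eq_square)
    also have "4 * (sin \<theta>)\<^sup>2 = 2 - 2 * cos (2 * \<theta>)"
      by (simp add: cos_double_sin)
    finally show "p d - q d = (2 - 2 * cos (2 * \<theta>)) * (g d)\<^sup>2" .
  qed
  finally show ?thesis by (simp add: \<theta>_def sum_distrib_left)
qed

text \<open>For \<open>c = 1\<close> the form is twice the Dirichlet energy of the path and kills
  constants, whence the mean-zero condition. The constant for length \<open>n - 1\<close> is at
  least that for length \<open>n\<close>.\<close>

lemma path_form_ge_sym:
  assumes n: "n \<ge> 3" and sym: "\<And>d. 1 \<le> d \<Longrightarrow> d < n \<Longrightarrow> g (n - d) = g d"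
    and sum0: "(\<Sum>d\<in>{1..<n}. g d) = 0"
  shows "(2 - 2 * cos (2 * pi / real n)) * (\<Sum>d\<in>{1..<n}. (g d)\<^sup>2) \<le> path_form n 1 g"
proof -
  \<comment> \<open>Since \<open>g 1 = g (n - 1)\<close>, the path closes up to a cycle of length \<open>n - 1\<close> at no cost.\<close>
  define m where "m = n - 1"
  have m: "m \<ge> 2" and nm: "n = Suc m" using n by (auto simp: m_def)
  define x where "x a = g (a mod m + 1)" for a
  have xs: "(\<Sum>a<m. \<phi> (x a)) = (\<Sum>d\<in>{1..<n}. \<phi> (g d))" for \<phi> :: "real \<Rightarrow> real"
    unfolding nm
    by (rule sum.reindex_bij_witness[of _ "\<lambda>d. d - 1" "\<lambda>d. d + 1"]) (auto simp: x_def)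
  have poinc: "(2 - 2 * cos (2 * pi / real m)) * (\<Sum>a<m. (x a)\<^sup>2) \<le> (\<Sum>a<m. (x (a + 1) - x a)\<^sup>2)"
    using m xs[of "\<lambda>y. y"] sum0 by (intro cycle_poincare) (auto simp: x_def)
  have "(\<Sum>a<m. (x (a + 1) - x a)\<^sup>2) = (\<Sum>a<m - 1. (x (a + 1) - x a)\<^sup>2) + (x m - x (m - 1))\<^sup>2"
    using m by (cases m) auto
  also have "x m - x (m - 1) = 0"
    using m sym[of 1] by (simp add: x_def nm)
  also have "(\<Sum>a<m - 1. (x (a + 1) - x a)\<^sup>2) = (\<Sum>d\<in>{1..<n-1}. (g (d + 1) - g d)\<^sup>2)"
    unfolding nm
    by (rule sum.reindex_bij_witness[of _ "\<lambda>d. d - 1" "\<lambda>d. d + 1"]) (auto simp: x_def)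
  finally have "2 * (\<Sum>a<m. (x (a + 1) - x a)\<^sup>2) = path_form n 1 g"
    by (simp add: path_form_def sum_distrib_left power2_eq_square algebra_simps)
  moreover have "cos (2 * pi / real m) \<le> cos (2 * pi / real n)"
    using m by (intro cos_monotone_0_pi_le) (auto simp: nm field_simps)
  then have "(2 - 2 * cos (2 * pi / real n)) * (\<Sum>a<m. (x a)\<^sup>2)
      \<le> 2 * ((2 - 2 * cos (2 * pi / real m)) * (\<Sum>a<m. (x a)\<^sup>2))"
    unfolding mult.assoc[symmetric]
  proof (intro mult_right_mono sum_nonneg)
    show "2 - 2 * cos (2 * pi / real n) \<le> 2 * (2 - 2 * cos (2 * pi / real m))"
      if "cos (2 * pi / real m) \<le> cos (2 * pi / real n)"
      using that cos_le_one[of "2 * pi / real m"] by argo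
  qed auto
  ultimately show ?thesis using poinc unfolding xs[of "\<lambda>y. y\<^sup>2"] by argo
qed

text \<open>Modes 0 and 1 are the symmetric and antisymmetric cases, mode \<open>n - 1\<close>
  reduces to mode 1, and the remaining modes stay far enough from the ends for the crude
  bound.\<close>

lemma path_form_ge:
  assumes n: "n \<ge> 3" and r: "r < n"
    and sym: "\<And>d. 1 \<le> d \<Longrightarrow> d < n \<Longrightarrow> g (n - d) = (-1) ^ r * g d"
    and sum0: "r = 0 \<Longrightarrow> (\<Sum>d\<in>{1..<n}. g d) = 0"
  shows "(2 - 2 * cos (2 * pi / real n)) * (\<Sum>d\<in>{1..<n}. (g d)\<^sup>2)
    \<le> path_form n (cos (pi * real r / real n)) g"
proof -
  consider "r = 0" | "r = 1" | "r = n - 1" | "2 \<le> r" "r \<le> n - 2" using r by linarith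
  then show ?thesis
  proof cases
    case 1
    then show ?thesis using path_form_ge_sym[OF n, of g] sym sum0 by simp
  next
    case 2
    then show ?thesis using path_form_ge_antisym[OF n, of g] sym by simp
  next
    case 3
    \<comment> \<open>Alternating signs reverse the sign of the coupling and restore antisymmetry,
      because \<open>n - d + r + d = 2 * r + 1\<close> is odd.\<close>
    define f where "f d = (-1) ^ d * g d" for d
    have f2: "(f d)\<^sup>2 = (g d)\<^sup>2" for d by (simp add: f_def power_mult_distrib flip: power_mult)
    have "pi * real r / real n = pi - pi / real n"
      using 3 n by (simp add: of_nat_diff field_simps)
    then have "cos (pi * real r / real n) = - cos (pi / real n)" by simp
    moreover have "f d * f (d + 1) = - (g d * g (d + 1))" for d
      by (simp add: f_def flip: power_add power_mult)
    then have "path_form n (- cos (pi / real n)) g = path_form n (cos (pi / real n)) f"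
      unfolding path_form_def f2 by (simp add: mult.assoc)
    moreover have "f (n - d) = - f d" if "1 \<le> d" "d < n" for d
    proof -
      have "(-1 :: real) ^ (n - d) * (-1) ^ r = - ((-1) ^ d)"
      proof -
        have eq: "n - d + r + d = 2 * r + 1" using that 3 by simp
        have "(-1 :: real) ^ (n - d) * (-1) ^ r * (-1) ^ d = -1"
          unfolding power_add[symmetric] eq by simp
        then show ?thesis
          by (metis (no_types) minus_one_mult_self mult.assoc mult.right_neutral mult_minus1 power_add)
      qed
      then show ?thesis using sym[OF that] by (simp add: f_def flip: mult.assoc)
    qed
    ultimately show ?thesis using path_form_ge_antisym[OF n, of f] by (simp add: f2)
  next
    case 4
    \<comment> \<open>The angle \<open>pi * r / n\<close> keeps distance \<open>2 * pi / n\<close>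
      from both 0 and \<open>pi\<close>, so its cosine is at most \<open>cos (2 * pi / n)\<close> in
      absolute value.\<close>
    have "2 * pi \<le> pi * real r" "pi * (real r + 2) \<le> pi * real n"
      using 4 n by auto
    then have b: "2 * pi / real n \<le> pi * real r / real n" "pi * real r / real n \<le> pi - 2 * pi / real n"
      using n by (auto simp: field_simps)
    have "0 \<le> 2 * pi / real n" "0 \<le> pi * real r / real n" by auto
    then have "cos (pi * real r / real n) \<le> cos (2 * pi / real n)"
      "cos (pi - 2 * pi / real n) \<le> cos (pi * real r / real n)"
      using b by (intro cos_monotone_0_pi_le; linarith)+
    then show ?thesis using n by (intro path_form_ge_bulk) auto
  qed
qed

section \<open>Fourier reduction of two tokens to the path forms\<close>

text \<open>Both hops carry the same phase \<open>cis t\<close>, so the \<open>sin t\<close> cross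
  terms cancel in the sum and the real and imaginary parts decouple.\<close>

lemma centred_mode_energy:
  fixes g g' :: complex and t :: real
  shows "(cmod (g' - cis t * g))\<^sup>2 + (cmod (g - cis t * g'))\<^sup>2 =
    (2 * (Re g)\<^sup>2 + 2 * (Re g')\<^sup>2 - 4 * cos t * Re g * Re g') +
    (2 * (Im g)\<^sup>2 + 2 * (Im g')\<^sup>2 - 4 * cos t * Im g * Im g')"
proof -
  have "y * (y * (cos t * cos t)) + y * (y * (sin t * sin t)) = y * y" for y
    using sin_cos_squared_add[of t] unfolding power2_eq_square
    by (metis add.commute distrib_left mult.right_neutral)
  from this[of "Re g"] this[of "Re g'"] this[of "Im g"] this[of "Im g'"]
  show ?thesis unfolding cmod_power2 by (simp add: power2_eq_square algebra_simps)
qed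

text \<open>Here \<open>h a d\<close> is the value at the tokens \<open>a\<close> and
  \<open>a + d\<close>, and \<open>sym\<close> says that a pair may be described from either token.
  The two squares are the hops of the token at \<open>a\<close> and of the token at
  \<open>a + d\<close>, each to the next vertex.\<close>

lemma pair_poincare:
  fixes h :: "nat \<Rightarrow> nat \<Rightarrow> real"
  assumes n: "n \<ge> 3" and per: "\<And>a d. h (a + n) d = h a d"
    and sym: "\<And>a d. 1 \<le> d \<Longrightarrow> d < n \<Longrightarrow> h (a + d) (n - d) = h a d"
    and sum0: "(\<Sum>a<n. \<Sum>d\<in>{1..<n}. h a d) = 0"
  shows "(2 - 2 * cos (2 * pi / real n)) * (\<Sum>a<n. \<Sum>d\<in>{1..<n}. (h a d)\<^sup>2) \<le>
    (\<Sum>a<n. \<Sum>d\<in>{1..<n-1}. (h a (d + 1) - h (a + 1) d)\<^sup>2 + (h a d - h a (d + 1))\<^sup>2)"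
    (is "?l * ?N \<le> ?E")
proof -
  define F where "F r d = dft n (\<lambda>a. h a d) r" for r d
  define E where "E r d = (cmod (dft n (\<lambda>a. h a (d + 1) - h (a + 1) d) r))\<^sup>2 +
    (cmod (dft n (\<lambda>a. h a d - h a (d + 1)) r))\<^sup>2" for r d
  have mode: "?l * (\<Sum>d\<in>{1..<n}. (cmod (F r d))\<^sup>2) \<le> (\<Sum>d\<in>{1..<n-1}. E r d)" if r: "r < n" for r
  proof -
    \<comment> \<open>Half the phase of a unit shift. Multiplying by \<open>cis (- (d * t))\<close>
      below moves the reference point from the first token to the centre of mass
      \<open>a + d / 2\<close>.\<close>
    define t where "t = pi * real r / real n"
    define g where "g d = cis (- (real d * t)) * F r d" for d
    have Fg: "F r d = cis (real d * t) * g d" for d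
      by (simp add: g_def cis_mult flip: mult.assoc)
    have "dft n (\<lambda>a. h (a + 1) d) r = cis (2 * t) * F r d" for d
      using n per dft_shift[of n "\<lambda>a. h a d" 1 r] by (simp add: F_def t_def mult_ac)
    then have "E r d = (cmod (F r (d + 1) - cis (2 * t) * F r d))\<^sup>2 + (cmod (F r d - F r (d + 1)))\<^sup>2" for d
      by (simp only: E_def dft_diff F_def)
    moreover have "F r (d + 1) - cis (2 * t) * F r d = cis (real (d + 1) * t) * (g (d + 1) - cis t * g d)" for d
    proof -
      have "2 * t + real d * t = real (d + 1) * t + t" by (simp add: algebra_simps)
      then show ?thesis
        unfolding Fg right_diff_distrib by (simp only: cis_mult mult.assoc[symmetric])
    qed
    moreover have "F r d - F r (d + 1) = cis (real d * t) * (g d - cis t * g (d + 1))" for d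
    proof -
      have "real (d + 1) * t = real d * t + t" by (simp add: algebra_simps)
      then show ?thesis
        unfolding Fg right_diff_distrib by (simp only: cis_mult mult.assoc[symmetric])
    qed
    ultimately have "E r d = (cmod (g (d + 1) - cis t * g d))\<^sup>2 + (cmod (g d - cis t * g (d + 1)))\<^sup>2" for d
      by (simp add: norm_mult)
    then have E: "(\<Sum>d\<in>{1..<n-1}. E r d) =
        path_form n (cos t) (\<lambda>d. Re (g d)) + path_form n (cos t) (\<lambda>d. Im (g d))"
      by (simp only: centred_mode_energy path_form_def sum.distrib)
    have N: "(cmod (F r d))\<^sup>2 = (Re (g d))\<^sup>2 + (Im (g d))\<^sup>2" for d
      by (simp add: Fg norm_mult flip: cmod_power2)
    \<comment> \<open>Exchanging the tokens shifts the base point by \<open>d\<close>; after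
      centring, the phase left over is \<open>n * t = r * pi\<close>, the source of the
      sign.\<close>
    have gsym: "g (n - d) = (-1) ^ r * g d" if d: "1 \<le> d" "d < n" for d
    proof -
      have "F r d = dft n (\<lambda>a. h (a + d) (n - d)) r" using sym[OF d] by (simp add: F_def)
      also have "\<dots> = cis (2 * (real d * t)) * F r (n - d)"
        using n per dft_shift[of n "\<lambda>a. h a (n - d)" d r] by (simp add: F_def t_def mult_ac)
      finally have "cis (real d * t) * g d = cis (2 * (real d * t)) * (cis (real (n - d) * t) * g (n - d))"
        unfolding Fg .
      also have "\<dots> = cis (2 * (real d * t) + real (n - d) * t) * g (n - d)"
        by (simp add: cis_mult flip: mult.assoc)
      also have "2 * (real d * t) + real (n - d) * t = real d * t + real r * pi"
        using d by (simp add: of_nat_diff algebra_simps) (simp add: t_def)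
      also have "cis (real d * t + real r * pi) = cis (real d * t) * (-1) ^ r"
        by (simp add: DeMoivre flip: cis_mult cis_pi)
      finally have "g d = (-1) ^ r * g (n - d)" by simp
      then have "(-1) ^ r * g d = ((-1) ^ r * (-1) ^ r) * g (n - d)" by (simp only: mult.assoc)
      then show ?thesis by (simp flip: power_add mult_2)
    qed
    have g0: "(\<Sum>d\<in>{1..<n}. g d) = 0" if "r = 0"
    proof -
      have "(\<Sum>d\<in>{1..<n}. g d) = of_real (\<Sum>d\<in>{1..<n}. \<Sum>a<n. h a d)"
        by (simp add: g_def t_def F_def that dft_0)
      also have "(\<Sum>d\<in>{1..<n}. \<Sum>a<n. h a d) = 0" using sum0 by (subst sum.swap)
      finally show ?thesis by simp
    qed
    \<comment> \<open>The sign is real, so the real and imaginary parts of \<open>g\<close> inherit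
      the parity separately.\<close>
    have m1: "((-1) ^ r :: complex) = of_real ((-1) ^ r)" by simp
    have "?l * (\<Sum>d\<in>{1..<n}. (Re (g d))\<^sup>2) \<le> path_form n (cos t) (\<lambda>d. Re (g d))"
      unfolding t_def
    proof (rule path_form_ge[OF n r])
      show "Re (g (n - d)) = (-1) ^ r * Re (g d)" if "1 \<le> d" "d < n" for d
        unfolding gsym[OF that] m1 by (simp del: of_real_power of_real_minus)
      show "(\<Sum>d\<in>{1..<n}. Re (g d)) = 0" if "r = 0"
        using arg_cong[OF g0[OF that], of Re] by simp
    qed
    moreover have "?l * (\<Sum>d\<in>{1..<n}. (Im (g d))\<^sup>2) \<le> path_form n (cos t) (\<lambda>d. Im (g d))"
      unfolding t_def
    proof (rule path_form_ge[OF n r])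
      show "Im (g (n - d)) = (-1) ^ r * Im (g d)" if "1 \<le> d" "d < n" for d
        unfolding gsym[OF that] m1 by (simp del: of_real_power of_real_minus)
      show "(\<Sum>d\<in>{1..<n}. Im (g d)) = 0" if "r = 0"
        using arg_cong[OF g0[OF that], of Im] by simp
    qed
    ultimately show ?thesis unfolding E N by (simp add: sum.distrib distrib_left)
  qed
  \<comment> \<open>Parseval in the base point \<open>a\<close>, for each fixed distance
    \<open>d\<close>, carries the bounds on the modes back to \<open>h\<close>.\<close>
  have "(\<Sum>r<n. ?l * (\<Sum>d\<in>{1..<n}. (cmod (F r d))\<^sup>2)) =
      ?l * (\<Sum>d\<in>{1..<n}. \<Sum>r<n. (cmod (F r d))\<^sup>2)"
    by (simp add: sum_distrib_left[symmetric] sum.swap[of _ "{..<n}"])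
  also have "\<dots> = ?l * (real n * ?N)"
    by (simp add: F_def parseval sum_distrib_left[symmetric] sum.swap[of _ "{..<n}"])
  finally have L: "(\<Sum>r<n. ?l * (\<Sum>d\<in>{1..<n}. (cmod (F r d))\<^sup>2)) = real n * (?l * ?N)"
    by (simp add: mult_ac)
  have "(\<Sum>r<n. \<Sum>d\<in>{1..<n-1}. E r d) = (\<Sum>d\<in>{1..<n-1}. \<Sum>r<n. E r d)" by (rule sum.swap)
  also have "\<dots> = real n * (\<Sum>d\<in>{1..<n-1}. \<Sum>a<n. (h a (d + 1) - h (a + 1) d)\<^sup>2 + (h a d - h a (d + 1))\<^sup>2)"
    by (simp only: E_def sum.distrib parseval distrib_left sum_distrib_left)
  also have "(\<Sum>d\<in>{1..<n-1}. \<Sum>a<n. (h a (d + 1) - h (a + 1) d)\<^sup>2 + (h a d - h a (d + 1))\<^sup>2) = ?E"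
    by (rule sum.swap)
  finally have R: "(\<Sum>r<n. \<Sum>d\<in>{1..<n-1}. E r d) = real n * ?E" .
  have "real n * (?l * ?N) \<le> real n * ?E"
    unfolding L[symmetric] R[symmetric] by (intro sum_mono mode) auto
  then show ?thesis using n by simp
qed

section \<open>Dirichlet forms of graphs containing a cycle\<close>

text \<open>Twice the Dirichlet form is a sum of squares over all oriented edges. The families
  \<open>p\<close> and \<open>q\<close> list distinct ones; the rest, among them the edges added to
  the cycle, contribute nonnegative terms.\<close>

lemma dirichlet_form_ge_oriented_edges:
  assumes fin: "finite (verts G)" "finite I"
    and p: "inj_on p I" "\<And>i. i \<in> I \<Longrightarrow> fst (p i) \<in> verts G \<and> snd (p i) \<in> verts G \<and> {fst (p i), snd (p i)} \<in> edges G"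
    and q: "inj_on q I" "\<And>i. i \<in> I \<Longrightarrow> fst (q i) \<in> verts G \<and> snd (q i) \<in> verts G \<and> {fst (q i), snd (q i)} \<in> edges G"
    and disj: "\<And>i j. i \<in> I \<Longrightarrow> j \<in> I \<Longrightarrow> p i \<noteq> q j"
  shows "(\<Sum>i\<in>I. (f (fst (p i)) - f (snd (p i)))\<^sup>2) + (\<Sum>i\<in>I. (f (fst (q i)) - f (snd (q i)))\<^sup>2)
    \<le> 2 * dirichlet_form G f"
proof -
  define \<phi> where "\<phi> e = (f (fst e) - f (snd e))\<^sup>2" for e
  define R where "R = (SIGMA u:verts G. {v. v \<in> verts G \<and> {u, v} \<in> edges G})"
  have R: "finite R" "2 * dirichlet_form G f = sum \<phi> R"
    using fin unfolding R_def by (auto simp: dirichlet_form_def sum.Sigma \<phi>_def case_prod_unfold)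
  have "sum \<phi> (p ` I) + sum \<phi> (q ` I) = sum \<phi> (p ` I \<union> q ` I)"
  proof (rule sum.union_disjoint[symmetric])
    show "p ` I \<inter> q ` I = {}" using disj by force
  qed (use fin in auto)
  also have "\<dots> \<le> sum \<phi> R"
    using R(1)
  proof (rule sum_mono2)
    show "p ` I \<union> q ` I \<subseteq> R"
    proof
      fix e assume "e \<in> p ` I \<union> q ` I"
      then obtain i where "i \<in> I" "e = p i \<or> e = q i" by blast
      then have "fst e \<in> verts G \<and> snd e \<in> verts G \<and> {fst e, snd e} \<in> edges G"
        using p(2)[of i] q(2)[of i] by auto
      then show "e \<in> R" by (cases e) (simp add: R_def)
    qed
  qed (simp add: \<phi>_def)
  finally show ?thesis using p(1) q(1) by (simp add: R(2) sum.reindex \<phi>_def)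
qed

lemma add_mod_less:
  fixes a d n :: nat
  assumes "a < n" "d < n"
  shows "(a + d) mod n = (if a + d < n then a + d else a + d - n)"
  using assms by (auto simp: mod_if)

text \<open>From length 3 on, a cycle has neither loops nor double edges, so the two orientations of
  its edges never coincide.\<close>

lemma succ_mod_neq:
  fixes i n :: nat
  assumes "n \<ge> 3" "i < n"
  shows "(i + 1) mod n \<noteq> i" "((i + 1) mod n + 1) mod n \<noteq> i"
proof -
  consider "i + 2 < n" | "n = i + 2" | "n = i + 1" using assms by linarith
  then have "(i + 1) mod n \<noteq> i \<and> ((i + 1) mod n + 1) mod n \<noteq> i"
    by cases (use assms(1) in auto)
  then show "(i + 1) mod n \<noteq> i" "((i + 1) mod n + 1) mod n \<noteq> i" by auto
qed

text \<open>A spanning cycle suffices. The parametrisation \<open>e\<close> lets the result cover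
  both \<open>G\<close> and its 1-token graph, whose vertices are singletons.\<close>

lemma cycle_poincare_embedded:
  assumes n: "n \<ge> 3" and e: "bij_betw e {..<n} (verts H)"
    and cyc: "\<And>i. i < n \<Longrightarrow> {e i, e ((i + 1) mod n)} \<in> edges H"
    and sum0: "(\<Sum>u\<in>verts H. f u) = 0"
  shows "(2 - 2 * cos (2 * pi / real n)) * (\<Sum>u\<in>verts H. (f u)\<^sup>2) \<le> dirichlet_form H f"
proof -
  define x where "x a = f (e (a mod n))" for a
  have fin: "finite (verts H)" using e by (metis bij_betw_finite finite_lessThan)
  have inj: "inj_on e {..<n}" using e by (simp add: bij_betw_def)
  have mem: "e i \<in> verts H" if "i < n" for i using e that by (auto simp: bij_betw_def)
  have reindex: "(\<Sum>u\<in>verts H. \<phi> (f u)) = (\<Sum>a<n. \<phi> (x a))" for \<phi> :: "real \<Rightarrow> real"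
    unfolding sum.reindex_bij_betw[OF e, symmetric] by (intro sum.cong) (auto simp: x_def)
  have eq: "e i = e j \<longleftrightarrow> i = j" if "i < n" "j < n" for i j
    using inj_on_eq_iff[OF inj] that by auto
  define p where "p i = (e i, e ((i + 1) mod n))" for i
  define q where "q i = (e ((i + 1) mod n), e i)" for i
  have "(\<Sum>i<n. (f (fst (p i)) - f (snd (p i)))\<^sup>2) + (\<Sum>i<n. (f (fst (q i)) - f (snd (q i)))\<^sup>2)
      \<le> 2 * dirichlet_form H f"
  proof (rule dirichlet_form_ge_oriented_edges[OF fin])
    show "inj_on p {..<n}" "inj_on q {..<n}" by (auto simp: p_def q_def inj_on_def eq)
    show "p i \<noteq> q j" if "i \<in> {..<n}" "j \<in> {..<n}" for i j
    proof
      assume pq: "p i = q j"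
      have ij: "i < n" "j < n" using that by auto
      have lt: "(i + 1) mod n < n" "(j + 1) mod n < n" using n by auto
      have "i = (j + 1) mod n" using pq eq[OF ij(1) lt(2)] by (simp add: p_def q_def)
      moreover have "(i + 1) mod n = j" using pq eq[OF lt(1) ij(2)] by (simp add: p_def q_def)
      ultimately show False using succ_mod_neq(2)[OF n ij(2)] by metis
    qed
  qed (use n cyc mem in \<open>auto simp: p_def q_def insert_commute\<close>)
  also have "(\<Sum>i<n. (f (fst (p i)) - f (snd (p i)))\<^sup>2) = (\<Sum>i<n. (x (i + 1) - x i)\<^sup>2)"
    by (intro sum.cong) (auto simp: p_def x_def power2_commute)
  also have "(\<Sum>i<n. (f (fst (q i)) - f (snd (q i)))\<^sup>2) = (\<Sum>i<n. (x (i + 1) - x i)\<^sup>2)"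
    by (intro sum.cong) (auto simp: q_def x_def)
  finally have "(\<Sum>i<n. (x (i + 1) - x i)\<^sup>2) \<le> dirichlet_form H f" by simp
  moreover have "(2 - 2 * cos (2 * pi / real n)) * (\<Sum>a<n. (x a)\<^sup>2) \<le> (\<Sum>a<n. (x (a + 1) - x a)\<^sup>2)"
    using n sum0 reindex[of "\<lambda>y. y"] by (intro cycle_poincare) (auto simp: x_def)
  ultimately show ?thesis using reindex[of "\<lambda>y. y\<^sup>2"] by simp
qed

section \<open>Token graphs\<close>

lemma verts_token_graph: "verts (token_graph k G) = {A. A \<subseteq> verts G \<and> finite A \<and> card A = k}"
  by (simp add: token_graph_def Let_def)

lemma edges_token_graph_iff:
  assumes "A \<in> verts (token_graph k G)" "B \<in> verts (token_graph k G)"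
  shows "{A, B} \<in> edges (token_graph k G) \<longleftrightarrow> (\<exists>a b. {a, b} \<in> edges G \<and> sym_diff A B = {a, b})"
proof
  assume "{A, B} \<in> edges (token_graph k G)"
  then obtain A' B' a b where *: "{A, B} = {A', B'}" "{a, b} \<in> edges G" "sym_diff A' B' = {a, b}"
    by (auto simp: token_graph_def Let_def)
  then have "sym_diff A B = {a, b}" by (auto simp: doubleton_eq_iff)
  with * show "\<exists>a b. {a, b} \<in> edges G \<and> sym_diff A B = {a, b}" by blast
next
  assume "\<exists>a b. {a, b} \<in> edges G \<and> sym_diff A B = {a, b}"
  with assms show "{A, B} \<in> edges (token_graph k G)"
    unfolding token_graph_def Let_def by auto
qed

lemma token_graph_loopfree: "{A} \<notin> edges (token_graph k G)"
  by (auto simp: token_graph_def Let_def)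

lemma finite_verts_token_graph:
  assumes "finite (verts G)"
  shows "finite (verts (token_graph k G))"
  using assms by (auto simp: verts_token_graph intro: finite_subset[of _ "Pow (verts G)"])

text \<open>Sets of equal size whose symmetric difference has two elements differ by one element on
  each side: one token moves along one edge.\<close>

lemma token_graph_neighbourE:
  assumes loopfree: "\<And>u. {u} \<notin> edges G"
    and A: "A \<in> verts (token_graph k G)" and B: "B \<in> verts (token_graph k G)"
    and AB: "{A, B} \<in> edges (token_graph k G)"
  obtains i j where "i \<in> A" "j \<in> verts G - A" "{i, j} \<in> edges G" "B = insert j (A - {i})"
proof -
  obtain a b where ab: "{a, b} \<in> edges G" "sym_diff A B = {a, b}"
    using AB edges_token_graph_iff[OF A B] by blast
  have "a \<noteq> b" using ab loopfree by auto
  have fin: "finite A" "finite B" "card A = card B" using A B by (auto simp: verts_token_graph)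
  have "card A = card (A \<inter> B) + card (A - B)" "card B = card (B \<inter> A) + card (B - A)"
    by (rule card_Int_Diff[OF fin(1)], rule card_Int_Diff[OF fin(2)])
  moreover have "card (A - B) + card (B - A) = 2"
    using fin ab(2) \<open>a \<noteq> b\<close> by (subst card_Un_disjoint[symmetric]) auto
  ultimately have "card (A - B) = 1" "card (B - A) = 1" using fin(3) unfolding Int_commute[of B] by linarith+
  then obtain i j where ij: "A - B = {i}" "B - A = {j}" by (metis card_1_singletonE)
  then have "{i, j} = {a, b}" using ab(2) by auto
  show thesis
  proof
    show "i \<in> A" "j \<in> verts G - A" using ij B by (auto simp: verts_token_graph)
    show "{i, j} \<in> edges G" using \<open>{i, j} = {a, b}\<close> ab(1) by simp
    show "B = insert j (A - {i})" using ij by blast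
  qed
qed

text \<open>Moving a token from \<open>i\<close> to \<open>j\<close> changes the sum by
  \<open>y i - y j\<close>. Moves onto occupied vertices are missing on the left, but on the right
  their contributions cancel in pairs.\<close>

lemma graph_laplacian_token_graph:
  assumes fin: "finite (verts G)" and loopfree: "\<And>u. {u} \<notin> edges G"
    and A: "A \<in> verts (token_graph k G)"
  shows "graph_laplacian (token_graph k G) (\<lambda>B. \<Sum>i\<in>B. y i) A = (\<Sum>i\<in>A. graph_laplacian G y i)"
proof -
  have Av: "A \<subseteq> verts G" "finite A" "card A = k" using A by (auto simp: verts_token_graph)
  let ?P = "SIGMA i:A. {j \<in> verts G - A. {i, j} \<in> edges G}"
  let ?N = "{B. B \<in> verts (token_graph k G) \<and> {A, B} \<in> edges (token_graph k G)}"
  have "bij_betw (\<lambda>(i, j). insert j (A - {i})) ?P ?N"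
    unfolding bij_betw_def
  proof
    show "inj_on (\<lambda>(i, j). insert j (A - {i})) ?P"
    proof (rule inj_onI, clarify)
      fix i j i' j' assume *: "i \<in> A" "i' \<in> A" "j \<notin> A" "j' \<notin> A" "insert j (A - {i}) = insert j' (A - {i'})"
      from * have "j \<in> insert j' (A - {i'})" by blast
      with * have "j = j'" by blast
      moreover from * have "i \<notin> insert j (A - {i})" by blast
      with * have "i = i'" by simp
      ultimately show "i = i' \<and> j = j'" by simp
    qed
    show "(\<lambda>(i, j). insert j (A - {i})) ` ?P = ?N"
    proof (intro equalityI subsetI)
      fix B assume "B \<in> (\<lambda>(i, j). insert j (A - {i})) ` ?P"
      then obtain i j where ij: "i \<in> A" "j \<in> verts G" "j \<notin> A" "{i, j} \<in> edges G" "B = insert j (A - {i})"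
        by auto
      have "card A > 0" using Av(2) ij(1) by (auto simp: card_gt_0_iff)
      then have "B \<in> verts (token_graph k G)"
        using ij Av by (auto simp: verts_token_graph)
      moreover have "sym_diff A B = {i, j}" using ij by auto
      ultimately show "B \<in> ?N" using ij(4) edges_token_graph_iff[OF A] by blast
    next
      fix B assume "B \<in> ?N"
      then have B: "B \<in> verts (token_graph k G)" "{A, B} \<in> edges (token_graph k G)" by auto
      obtain i j where "i \<in> A" "j \<in> verts G - A" "{i, j} \<in> edges G" "B = insert j (A - {i})"
        by (rule token_graph_neighbourE[OF loopfree A B])
      then show "B \<in> (\<lambda>(i, j). insert j (A - {i})) ` ?P"
        by (intro image_eqI[of _ _ "(i, j)"]) auto
    qed
  qed
  then have "graph_laplacian (token_graph k G) (\<lambda>B. \<Sum>i\<in>B. y i) A =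
      (\<Sum>(i, j)\<in>?P. (\<Sum>l\<in>A. y l) - (\<Sum>l\<in>insert j (A - {i}). y l))"
    unfolding graph_laplacian_def
    by (subst sum.reindex_bij_betw[symmetric]) (auto simp: case_prod_unfold)
  also have "\<dots> = (\<Sum>(i, j)\<in>?P. y i - y j)"
    using Av(2) by (intro sum.cong) (auto simp: sum.remove)
  also have "\<dots> = (\<Sum>i\<in>A. \<Sum>j | j \<in> verts G - A \<and> {i, j} \<in> edges G. y i - y j)"
    using Av(2) fin by (subst sum.Sigma) auto
  \<comment> \<open>The forbidden moves form the Laplacian of the subgraph induced on
    \<open>A\<close>, which sums to 0.\<close>
  also have "\<dots> = (\<Sum>i\<in>A. graph_laplacian G y i - graph_laplacian (A, edges G) y i)"
  proof (intro sum.cong refl)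
    fix i assume "i \<in> A"
    have "{j. j \<in> verts G \<and> {i, j} \<in> edges G} =
        {j. j \<in> verts G - A \<and> {i, j} \<in> edges G} \<union> {j. j \<in> A \<and> {i, j} \<in> edges G}"
      using Av(1) by auto
    then show "(\<Sum>j | j \<in> verts G - A \<and> {i, j} \<in> edges G. y i - y j) =
        graph_laplacian G y i - graph_laplacian (A, edges G) y i"
      using fin Av(2) unfolding graph_laplacian_def
      by (simp, subst sum.union_disjoint) auto
  qed
  also have "\<dots> = (\<Sum>i\<in>A. graph_laplacian G y i)"
    using sum_graph_laplacian[of "(A, edges G)" y] Av(2) by (simp add: sum_subtractf)
  finally show ?thesis .
qed

section \<open>Two tokens in cyclic coordinates\<close>

text \<open>Either element of a pair can serve as the base point \<open>a\<close>, and the distance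
  \<open>d\<close> is then determined modulo \<open>n\<close>.\<close>

lemma sum_pairs_by_distance:
  fixes \<psi> :: "nat set \<Rightarrow> real"
  shows "(\<Sum>a<n. \<Sum>d\<in>{1..<n}. \<psi> {a, (a + d) mod n}) =
    2 * (\<Sum>A | A \<subseteq> {..<n} \<and> finite A \<and> card A = 2. \<psi> A)"
proof -
  have "(\<Sum>d\<in>{1..<n}. \<psi> {a, (a + d) mod n}) = (\<Sum>b\<in>{..<n} - {a}. \<psi> {a, b})" if "a < n" for a
    using that
    by (intro sum.reindex_bij_witness[of _ "\<lambda>b. if a < b then b - a else b + n - a" "\<lambda>d. (a + d) mod n"])
      (auto simp: add_mod_less split: if_splits)
  then have "(\<Sum>a<n. \<Sum>d\<in>{1..<n}. \<psi> {a, (a + d) mod n}) = (\<Sum>a<n. \<Sum>b\<in>{..<n} - {a}. \<psi> {a, b})"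
    by simp
  also have "\<dots> = (\<Sum>(a, b)\<in>(SIGMA a:{..<n}. {..<n} - {a}). \<psi> {a, b})"
    by (subst sum.Sigma) auto
  also have "(SIGMA a:{..<n}. {..<n} - {a}) = {(a, b). a < b \<and> b < n} \<union> {(a, b). b < a \<and> a < n}"
    by auto
  also have "(\<Sum>(a, b)\<in>\<dots>. \<psi> {a, b}) =
      (\<Sum>(a, b)\<in>{(a, b). a < b \<and> b < n}. \<psi> {a, b}) + (\<Sum>(a, b)\<in>{(a, b). b < a \<and> a < n}. \<psi> {a, b})"
    by (intro sum.union_disjoint) (auto intro: finite_subset[of _ "{..<n} \<times> {..<n}"])
  also have "(\<Sum>(a, b)\<in>{(a, b). b < a \<and> a < n}. \<psi> {a, b}) = (\<Sum>(a, b)\<in>{(a, b). a < b \<and> b < n}. \<psi> {a, b})"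
    by (intro sum.reindex_bij_witness[of _ prod.swap prod.swap]) (auto simp: insert_commute)
  also have "(\<Sum>(a, b)\<in>{(a, b). a < b \<and> b < n}. \<psi> {a, b}) =
      (\<Sum>A | A \<subseteq> {..<n} \<and> finite A \<and> card A = 2. \<psi> A)"
  proof -
    have "bij_betw (\<lambda>(a, b). {a, b}) {(a, b). a < b \<and> b < n} {A. A \<subseteq> {..<n} \<and> finite A \<and> card A = 2}"
      unfolding bij_betw_def
    proof
      show "inj_on (\<lambda>(a, b). {a, b}) {(a, b). a < b \<and> b < n}"
        by (auto simp: inj_on_def doubleton_eq_iff)
      show "(\<lambda>(a, b). {a, b}) ` {(a, b). a < b \<and> b < n} = {A. A \<subseteq> {..<n} \<and> finite A \<and> card A = 2}"
      proof (intro equalityI subsetI)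
        fix A assume A: "A \<in> {A. A \<subseteq> {..<n} \<and> finite A \<and> card A = 2}"
        then obtain a b where "A = {a, b}" "a \<noteq> b" by (auto simp: card_2_iff)
        then have "(min a b, max a b) \<in> {(a, b). a < b \<and> b < n}" "A = {min a b, max a b}"
          using A by (auto simp: min_def max_def)
        then show "A \<in> (\<lambda>(a, b). {a, b}) ` {(a, b). a < b \<and> b < n}"
          by (metis (mono_tags, lifting) case_prod_conv image_eqI)
      qed auto
    qed
    from sum.reindex_bij_betw[OF this, of \<psi>] show ?thesis by (simp add: case_prod_unfold)
  qed
  finally show ?thesis by simp
qed

text \<open>Transfers \<open>pair_poincare\<close> to the token graph: its sums run over the hops
  along the cycle, and hops along other edges only enlarge the Dirichlet form.\<close>

lemma two_token_poincare:
  assumes n: "n \<ge> 3" and V: "verts G = {..<n}"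
    and cyc: "\<And>i. i < n \<Longrightarrow> {i, (i + 1) mod n} \<in> edges G"
    and sum0: "(\<Sum>A\<in>verts (token_graph 2 G). f A) = 0"
  shows "(2 - 2 * cos (2 * pi / real n)) * (\<Sum>A\<in>verts (token_graph 2 G). (f A)\<^sup>2)
    \<le> dirichlet_form (token_graph 2 G) f"
proof -
  let ?T = "token_graph 2 G"
  define h where "h a d = f {a mod n, (a + d) mod n}" for a d
  have W: "verts ?T = {A. A \<subseteq> {..<n} \<and> finite A \<and> card A = 2}" by (simp add: verts_token_graph V)
  have fin: "finite (verts ?T)" using V by (intro finite_verts_token_graph) simp
  have reindex: "(\<Sum>a<n. \<Sum>d\<in>{1..<n}. \<phi> (h a d)) = 2 * (\<Sum>A\<in>verts ?T. \<phi> (f A))" for \<phi> :: "real \<Rightarrow> real"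
    using n sum_pairs_by_distance[where n = n and \<psi> = "\<lambda>A. \<phi> (f A)"] unfolding W h_def by simp
  \<comment> \<open>The distance stops at \<open>n - 2\<close>, so that \<open>d + 1\<close> never
    puts both tokens on one vertex.\<close>
  define I where "I = {..<n} \<times> {1..<n-1}"
  define s where "s a = (a + 1) mod n" for a
  define x where "x a d = (a + d) mod n" for a d
  have sx: "s (x a d) = x a (d + 1)" "x (s a) d = x a (d + 1)" for a d
    by (simp_all add: s_def x_def mod_simps)
  have lt: "s a < n" "x a d < n" for a d using n by (auto simp: s_def x_def)
  have s_neq: "s a \<noteq> a" "s (s a) \<noteq> a" if "a < n" for a
    using succ_mod_neq[OF n that] by (simp_all add: s_def)
  have x_neq: "x a d \<noteq> a" if "a < n" "1 \<le> d" "d < n" for a d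
    using that add_mod_less[of a n d] by (auto simp: x_def split: if_splits)
  have x_neq_s: "x a (d + 1) \<noteq> s a" if "a < n" "1 \<le> d" "d < n - 1" for a d
    using x_neq[of "s a" d] lt that by (simp add: sx)
  have x_inj: "d = d'" if "x a d = x a d'" "a < n" "d < n" "d' < n" for a d d'
    using that add_mod_less[of a n d] add_mod_less[of a n d'] by (auto simp: x_def split: if_splits)
  have edge: "{A, B} \<in> edges ?T" if "A \<in> verts ?T" "B \<in> verts ?T" "i < n" "sym_diff A B = {i, s i}" for A B i
    using that cyc[of i] edges_token_graph_iff[of A 2 G B] by (auto simp: s_def)
  \<comment> \<open>In \<open>p\<close> a token steps forward, in \<open>q\<close> a token steps
    backward. Each hop along the cycle thus occurs once in either family, with opposite
    orientations; a coincidence would give \<open>s (s b) = b\<close>.\<close>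
  define p where "p = (\<lambda>(a, d). ({a, x a d}, {a, x a (d + 1)}))"
  define q where "q = (\<lambda>(a, d). ({s a, x a (d + 1)}, {a, x a (d + 1)}))"
  have dist: "a \<noteq> x a d" "a \<noteq> x a (d + 1)" "x a d \<noteq> x a (d + 1)" "s a \<noteq> x a (d + 1)" "s a \<noteq> a"
    "a < n" "s a < n" "x a d < n" "x a (d + 1) < n"
    if "(a, d) \<in> I" for a d
  proof -
    have "a < n" "1 \<le> d" "d < n" "d < n - 1" "d + 1 < n" using that by (auto simp: I_def)
    then show "a \<noteq> x a d" "a \<noteq> x a (d + 1)" "x a d \<noteq> x a (d + 1)" "s a \<noteq> x a (d + 1)" "s a \<noteq> a"
      "a < n" "s a < n" "x a d < n" "x a (d + 1) < n"
      using x_neq[of a d] x_neq[of a "d + 1"] x_neq_s[of a d] s_neq[of a] s_neq(1)[of "x a d"] lt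
      unfolding sx by auto
  qed
  have "(\<Sum>i\<in>I. (f (fst (p i)) - f (snd (p i)))\<^sup>2) + (\<Sum>i\<in>I. (f (fst (q i)) - f (snd (q i)))\<^sup>2)
      \<le> 2 * dirichlet_form ?T f"
  proof (rule dirichlet_form_ge_oriented_edges[OF fin])
    show "finite I" by (simp add: I_def)
    show "inj_on p I"
    proof (rule inj_onI, clarify)
      fix a d b e assume ad: "(a, d) \<in> I" and be: "(b, e) \<in> I" and eq: "p (a, d) = p (b, e)"
      have "a = b \<and> x a d = x b e"
        using eq dist(1-3)[OF ad] dist(1-3)[OF be] by (auto simp: p_def doubleton_eq_iff)
      then show "a = b \<and> d = e" using ad be x_inj[of a d e] by (auto simp: I_def)
    qed
    show "inj_on q I"
    proof (rule inj_onI, clarify)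
      fix a d b e assume ad: "(a, d) \<in> I" and be: "(b, e) \<in> I" and eq: "q (a, d) = q (b, e)"
      have "a = b \<and> x a (d + 1) = x b (e + 1)"
        using eq dist(2,4,5)[OF ad] dist(2,4,5)[OF be] by (auto simp: q_def doubleton_eq_iff)
      then show "a = b \<and> d = e" using ad be x_inj[of a "d + 1" "e + 1"] by (auto simp: I_def)
    qed
    show "p i \<noteq> q j" if "i \<in> I" "j \<in> I" for i j
    proof
      assume eq: "p i = q j"
      obtain a d b e where ij: "i = (a, d)" "j = (b, e)" by (cases i; cases j)
      then have ad: "(a, d) \<in> I" and be: "(b, e) \<in> I" using that by auto
      have "x a d = s b \<and> x a (d + 1) = b"
        using eq dist(1-5)[OF ad] dist(1-5)[OF be] unfolding ij by (auto simp: p_def q_def doubleton_eq_iff)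
      then have "s (s b) = b" by (metis sx(1))
      then show False using s_neq[of b] be by (auto simp: I_def)
    qed
  next
    fix i assume i: "i \<in> I"
    obtain a d where ad: "i = (a, d)" by (cases i)
    note dist' = dist[OF i[unfolded ad]]
    have W': "{a, x a d} \<in> verts ?T" "{a, x a (d + 1)} \<in> verts ?T" "{s a, x a (d + 1)} \<in> verts ?T"
      unfolding W using dist' by auto
    have "{{a, x a d}, {a, x a (d + 1)}} \<in> edges ?T"
      using dist' W' sx by (intro edge[of _ _ "x a d"]) auto
    then show "fst (p i) \<in> verts ?T \<and> snd (p i) \<in> verts ?T \<and> {fst (p i), snd (p i)} \<in> edges ?T"
      using W' by (simp add: p_def ad)
    have "{{s a, x a (d + 1)}, {a, x a (d + 1)}} \<in> edges ?T"
      using dist' W' by (intro edge[of _ _ a]) auto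
    then show "fst (q i) \<in> verts ?T \<and> snd (q i) \<in> verts ?T \<and> {fst (q i), snd (q i)} \<in> edges ?T"
      using W' by (simp add: q_def ad)
  qed
  also have "(\<Sum>i\<in>I. (f (fst (p i)) - f (snd (p i)))\<^sup>2) = (\<Sum>(a, d)\<in>I. (h a d - h a (d + 1))\<^sup>2)"
    by (intro sum.cong) (auto simp: p_def I_def h_def x_def)
  also have "(\<Sum>i\<in>I. (f (fst (q i)) - f (snd (q i)))\<^sup>2) = (\<Sum>(a, d)\<in>I. (h a (d + 1) - h (a + 1) d)\<^sup>2)"
    by (intro sum.cong) (auto simp: q_def I_def h_def x_def s_def power2_commute)
  finally have "(\<Sum>a<n. \<Sum>d\<in>{1..<n-1}. (h a (d + 1) - h (a + 1) d)\<^sup>2 + (h a d - h a (d + 1))\<^sup>2)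
      \<le> 2 * dirichlet_form ?T f"
    unfolding I_def sum.cartesian_product[symmetric] by (simp add: sum.distrib)
  moreover have "(2 - 2 * cos (2 * pi / real n)) * (\<Sum>a<n. \<Sum>d\<in>{1..<n}. (h a d)\<^sup>2) \<le>
    (\<Sum>a<n. \<Sum>d\<in>{1..<n-1}. (h a (d + 1) - h (a + 1) d)\<^sup>2 + (h a d - h a (d + 1))\<^sup>2)"
  proof (rule pair_poincare[OF n])
    show "h (a + n) d = h a d" for a d
      using mod_add_self2[of "a + d" n] by (simp add: h_def add.commute add.left_commute)
    show "h (a + d) (n - d) = h a d" if "1 \<le> d" "d < n" for a d
      using that by (simp add: h_def insert_commute)
    show "(\<Sum>a<n. \<Sum>d\<in>{1..<n}. h a d) = 0" using reindex[of "\<lambda>y. y"] sum0 by simp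
  qed
  \<comment> \<open>The factors 2 cancel: every pair has two descriptions \<open>(a, d)\<close>,
    every edge two orientations.\<close>
  ultimately show ?thesis unfolding reindex[of "\<lambda>y. y\<^sup>2"] by (simp add: mult.left_commute)
qed

section \<open>The eigenfunction that survives the added edges\<close>

lemma cos_second_difference:
  fixes x t :: real
  shows "2 * cos x - cos (x + t) - cos (x - t) = (2 - 2 * cos t) * cos x"
  by (simp add: cos_add cos_diff algebra_simps)

text \<open>The phase centres the lowest cosine wave at \<open>\<nu> / 2\<close>, so it agrees at
  \<open>i\<close> and \<open>\<nu> - i\<close>. Added edges therefore contribute nothing, and the
  second difference along the cycle remains.\<close>

lemma symmetric_cycle_eigenfunction:
  fixes n \<nu> :: nat
  defines "y \<equiv> \<lambda>i. cos (2 * pi * real i / real n - pi * real \<nu> / real n)"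
  assumes n: "n \<ge> 3" and S: "S \<subseteq> sum_edges n \<nu>" and i: "i < n"
  shows "graph_laplacian (add_edges (cycle_graph n) S) y i = (2 - 2 * cos (2 * pi / real n)) * y i"
proof -
  let ?G = "add_edges (cycle_graph n) S"
  let ?x = "2 * pi * real i / real n - pi * real \<nu> / real n"
  define s where "s = (i + 1) mod n"
  define r where "r = (i + (n - 1)) mod n"
  have s: "s = (if i + 1 = n then 0 else i + 1)" and r: "r = (if i = 0 then n - 1 else i - 1)"
    using i n add_mod_less[of i n 1] add_mod_less[of i n "n - 1"]
    unfolding s_def r_def by (auto split: if_splits)
  have nbr: "{s, r} \<subseteq> {j. j \<in> verts ?G \<and> {i, j} \<in> edges ?G}"
  proof -
    have "(r + 1) mod n = i" using i n unfolding r by auto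
    then have "\<exists>k<n. {i, r} = {k, (k + 1) mod n}" using i n by (intro exI[of _ r]) (auto simp: r)
    moreover have "\<exists>k<n. {i, s} = {k, (k + 1) mod n}" using i by (auto simp: s_def)
    moreover have "s < n" "r < n" using n by (auto simp: s_def r_def)
    ultimately show ?thesis by (auto simp: add_edges_def cycle_graph_def)
  qed
  have "graph_laplacian ?G y i = (\<Sum>j\<in>{s, r}. y i - y j)"
    unfolding graph_laplacian_def
  proof (rule sum.mono_neutral_right)
    show "finite {v \<in> verts ?G. {i, v} \<in> edges ?G}" by (simp add: add_edges_def cycle_graph_def)
    \<comment> \<open>A neighbour off the cycle is the mirror image \<open>\<nu> - i\<close>, where
      the argument of the cosine changes sign.\<close>
    show "\<forall>j\<in>{j \<in> verts ?G. {i, j} \<in> edges ?G} - {s, r}. y i - y j = 0"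
    proof
      fix j assume j: "j \<in> {j \<in> verts ?G. {i, j} \<in> edges ?G} - {s, r}"
      have "{i, j} \<noteq> {k, (k + 1) mod n}" if "k < n" for k
        using that j i n add_mod_less[of k n 1] by (auto simp: doubleton_eq_iff s r split: if_splits)
      then have "{i, j} \<in> S" using j by (auto simp: add_edges_def cycle_graph_def)
      then have "{i, j} \<in> sum_edges n \<nu>" using S by blast
      then have "i + j = \<nu>" by (auto simp: sum_edges_def doubleton_eq_iff)
      then have "2 * pi * real j / real n - pi * real \<nu> / real n = - ?x"
        using n by (auto simp: field_simps)
      then have "y j = y i" unfolding y_def by (metis cos_minus)
      then show "y i - y j = 0" by simp
    qed
  qed (rule nbr)
  also have "\<dots> = 2 * y i - y s - y r"
    using n i by (subst sum.insert) (auto simp: s r)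
  \<comment> \<open>Wrapping around the cycle changes the argument by a full period; the same
    happens for \<open>r\<close> below.\<close>
  also have "y s = cos (?x + 2 * pi / real n)"
  proof (cases "i + 1 = n")
    case True
    then have "?x + 2 * pi / real n = (2 * pi * real s / real n - pi * real \<nu> / real n) + 2 * pi"
      using n unfolding s by (auto simp: field_simps)
    then show ?thesis unfolding y_def by (simp only: cos_periodic)
  next
    case False
    then show ?thesis using n unfolding y_def s by (simp add: add_divide_distrib distrib_left algebra_simps)
  qed
  also have "y r = cos (?x - 2 * pi / real n)"
  proof (cases "i = 0")
    case True
    then have "2 * pi * real r / real n - pi * real \<nu> / real n = (?x - 2 * pi / real n) + 2 * pi"
      using n unfolding r by (auto simp: field_simps of_nat_diff)
    then show ?thesis unfolding y_def by (simp only: cos_periodic)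
  next
    case False
    then have "2 * pi * real r / real n - pi * real \<nu> / real n = ?x - 2 * pi / real n"
      using n unfolding r by (simp add: field_simps of_nat_diff)
    then show ?thesis unfolding y_def by (simp only:)
  qed
  finally show ?thesis unfolding y_def by (simp only: cos_second_difference)
qed

theorem theorem3p7:
  fixes n \<nu> k :: nat and S :: "nat set set" and G :: "nat graph"
  assumes "n \<ge> 3"
    and "odd n \<Longrightarrow> \<nu> = n"
    and "even n \<Longrightarrow> \<nu> \<in> {n, n - 1}"
    and "S \<subseteq> sum_edges n \<nu>"
    and "G = add_edges (cycle_graph n) S"
    and "k \<in> {1, 2}"
  shows "algebraic_connectivity (token_graph k G) = algebraic_connectivity G"
proof -
  note n = assms(1)
  define l where "l = 2 - 2 * cos (2 * pi / real n)"
  define y where "y i = cos (2 * pi * real i / real n - pi * real \<nu> / real n)" for i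
  have V: "verts G = {..<n}" and cyc: "\<And>i. i < n \<Longrightarrow> {i, (i + 1) mod n} \<in> edges G"
    using assms(5) by (auto simp: add_edges_def cycle_graph_def)
  have fin: "finite (verts G)" by (simp add: V)
  have loopfree: "{u} \<notin> edges G" for u
  proof
    assume "{u} \<in> edges G"
    then consider i where "i < n" "{u} = {i, (i + 1) mod n}" | "{u} \<in> sum_edges n \<nu>"
      using assms(4,5) by (auto simp: add_edges_def cycle_graph_def)
    then show False
    proof cases
      case 1
      then show False using succ_mod_neq(1)[OF n 1(1)] by auto
    qed (auto simp: sum_edges_def)
  qed
  have "cos (2 * pi / real n) < cos 0"
    using n by (intro cos_monotone_0_pi) (auto simp: field_simps)
  then have pos: "0 < l" by (simp add: l_def)
  have eigen: "graph_laplacian G y i = l * y i" if "i \<in> verts G" for i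
    using symmetric_cycle_eigenfunction[OF n assms(4), of i] that V
    unfolding assms(5) y_def l_def by simp
  \<comment> \<open>This is where the admissible values of \<open>\<nu>\<close> enter:
    \<open>y 0\<close> is \<open>-1\<close> or \<open>- cos (pi / n)\<close>.\<close>
  have y0: "y 0 \<noteq> 0"
  proof -
    have "\<nu> = n \<or> \<nu> = n - 1" using assms(2,3) by auto
    then have "pi * real \<nu> / real n = pi \<or> pi * real \<nu> / real n = pi - pi / real n"
      using n by (auto simp: of_nat_diff field_simps)
    moreover have "0 < cos (pi / real n)"
      using n by (intro cos_gt_zero_pi) (auto simp: field_simps intro: less_le_trans[of _ 0])
    ultimately show ?thesis unfolding y_def by auto
  qed
  have "algebraic_connectivity G = l"
  proof (rule algebraic_connectivity_eqI[OF fin loopfree pos _ eigen])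
    show "l * (\<Sum>u\<in>verts G. (f u)\<^sup>2) \<le> dirichlet_form G f" if "(\<Sum>u\<in>verts G. f u) = 0" for f
      unfolding l_def using that cyc V by (intro cycle_poincare_embedded[OF n, of "\<lambda>i. i"]) (auto simp: bij_betw_def)
    show "0 \<in> verts G" using n V by simp
  qed (use y0 in auto)
  moreover have "algebraic_connectivity (token_graph k G) = l"
  proof -
    let ?T = "token_graph k G"
    define Y where "Y A = (\<Sum>i\<in>A. y i)" for A
    have eig: "graph_laplacian ?T Y A = l * Y A" if "A \<in> verts ?T" for A
    proof -
      have "graph_laplacian ?T Y A = (\<Sum>i\<in>A. graph_laplacian G y i)"
        unfolding Y_def using graph_laplacian_token_graph[OF fin loopfree that] .
      also have "\<dots> = (\<Sum>i\<in>A. l * y i)"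
        using that by (intro sum.cong refl eigen) (auto simp: verts_token_graph)
      finally show ?thesis by (simp add: Y_def sum_distrib_left)
    qed
    have "\<exists>A\<in>verts ?T. Y A \<noteq> 0"
    proof (cases "k = 1")
      case True
      then have "{0} \<in> verts ?T" "Y {0} \<noteq> 0" using n V y0 by (auto simp: verts_token_graph Y_def)
      then show ?thesis by blast
    next
      case False
      then have "k = 2" using assms(6) by simp
      then have "{0, 1} \<in> verts ?T" "{0, 2} \<in> verts ?T" "{1, 2} \<in> verts ?T"
        using n V by (auto simp: verts_token_graph)
      \<comment> \<open>A combination of three pair sums that isolates \<open>y 0\<close>, so they
        cannot all vanish.\<close>
      moreover have "Y {0, 1} + Y {0, 2} - Y {1, 2} = 2 * y 0" by (simp add: Y_def)
      then have "Y {0, 1} \<noteq> 0 \<or> Y {0, 2} \<noteq> 0 \<or> Y {1, 2} \<noteq> 0" using y0 by auto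
      ultimately show ?thesis by blast
    qed
    then obtain A where A: "A \<in> verts ?T" "Y A \<noteq> 0" by blast
    show ?thesis
    proof (rule algebraic_connectivity_eqI[OF finite_verts_token_graph[OF fin] token_graph_loopfree pos _ eig A])
      show "l * (\<Sum>u\<in>verts ?T. (f u)\<^sup>2) \<le> dirichlet_form ?T f" if f: "(\<Sum>u\<in>verts ?T. f u) = 0" for f
      proof (cases "k = 1")
        case True
        \<comment> \<open>The 1-token graph is a copy of \<open>G\<close> on singletons, so the
          cycle embeds by \<open>i \<mapsto> {i}\<close>.\<close>
        have W: "verts ?T = (\<lambda>i. {i}) ` {..<n}"
          by (auto simp: verts_token_graph V True card_1_singleton_iff)
        show ?thesis unfolding l_def
        proof (rule cycle_poincare_embedded[OF n _ _ f])
          show "bij_betw (\<lambda>i. {i}) {..<n} (verts ?T)" unfolding W by (simp add: bij_betw_def)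
          show "{{i}, {(i + 1) mod n}} \<in> edges ?T" if "i < n" for i
          proof -
            have "{i} \<in> verts ?T" "{(i + 1) mod n} \<in> verts ?T" using that n by (auto simp: W)
            moreover have "(i + 1) mod n \<noteq> i" using loopfree[of i] cyc[OF that] by auto
            then have "sym_diff {i} {(i + 1) mod n} = {i, (i + 1) mod n}" by auto
            ultimately show ?thesis using edges_token_graph_iff cyc[OF that] by blast
          qed
        qed
      next
        case False
        then have "k = 2" using assms(6) by simp
        then show ?thesis using two_token_poincare[OF n V cyc, of f] f by (simp add: l_def)
      qed
    qed
  qed
  ultimately show ?thesis by simp
qed

end
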